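(* Let $V=\bigoplus_{i\in\mathbb Z/n\mathbb Z}V_i$ be an $n$-colored vector space and fix $m\in\mathbb Z/n\mathbb Z$. The map $\Psi$ induces a bijection from the set of row-equivalence classes of striped $n$-bipartitions $(\lambda,\epsilon,\mu)$ of signature $\xi(V)$ satisfying $\epsilon_i+[\lambda_i-\mu_i]=m$ for all $i$ onto the set $K\backslash(V_m\times\mathcal N)$ of $K$-orbits in $V_m\times\mathcal N$.
   Context: Fix an integer $n\ge 1$; write $[a]$ for the class of $a\in\mathbb Z$ in $\mathbb Z/n\mathbb Z$. An $n$-colored vector space is a finite-dimensional vector space $V$ over a field with a decomposition $V=\bigoplus_{i\in\mathbb Z/n\mathbb Z}V_i$. Its signature is $\xi_i(V)=\dim V_i$. Put $K=\prod_iGL(V_i)$ and $\mathcal N=\{x\in\mathrm{End}(V): x\text{ nilpotent},\ xV_i\subset V_{i+[1]}\ \forall i\}$. $K$ acts on $V\times\mathcal N$ by $k\cdot(v,x)=(kv,kxk^{-1})$. A partition is a weakly decreasing $\lambda:\mathbb N=\{1,2,\dots\}\to\mathbb Z^{\ge0}$ that is eventually $0$; $l(\lambda)=\#\{i:\lambda_i>0\}$. A colored partition is $(\lambda,\epsilon)$ with $\lambda$ a partition and $\epsilon:\mathbb N\to\mathbb Z/n\mathbb Z$ taking each value infinitely often. Its signature is $\xi_m(\lambda,\epsilon)=\#\{(i,j):1\le j\le\lambda_i,\ \epsilon_i+[\lambda_i-j]=m\}$. For a colored partition of signature $\xi(V)$, a colored Jordan basis of type $(\lambda,\epsilon)$ for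 $x\in\mathcal N$ is a basis $\{v_{i,j}:1\le i\le l(\lambda),1\le j\le\lambda_i\}$ of $V$ with $v_{i,j}\in V_{\epsilon_i+[\lambda_i-j]}$, $xv_{i,j}=v_{i,j-1}$ for $j>1$ and $xv_{i,1}=0$. Convention: $v_{i,j}=0$ for $j\le0$. A marking of $\lambda$ is $\mu:\mathbb N\to\mathbb Z$ with $\mu_i\le\lambda_i$; put $\nu=\lambda-\mu$. The marked colored partition $(\lambda,\epsilon,\mu)$ (of signature $\xi(\lambda,\epsilon)$) is a striped $n$-bipartition if $\mu_i>-n$ for all $i$, $\mu_j<\mu_i+n$ and $\nu_j<\nu_i+n$ for all $i<j$, and $\epsilon_i+[\nu_i]=\epsilon_j+[\nu_j]$ for all $i,j$. Row-equivalence: permuting rows of equal length along with their colors and marks. $\Psi(\lambda,\epsilon,\mu)$, for a marked colored partition of signature $\xi(V)$, is the $K$-orbit of $(v,x)$, where $x\in\mathcal N$ has a colored Jordan basis $\{v_{i,j}\}$ of type $(\lambda,\epsilon)$ and $v=\sum_{i=1}^{l(\lambda)}v_{i,\mu_i}$; it is independent of choices. *)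

theory Defs
  imports Complex_Main "HOL-Library.FuncSet"
begin

text \<open>
  The class of an integer \<open>a\<close> in \<open>\<int>/n\<int>\<close> is represented by \<open>a mod int n\<close>, so
  \<open>\<int>/n\<int>\<close> itself is the set of residues \<open>{0..<int n}\<close>.
\<close>

definition colors :: "nat \<Rightarrow> int set" where
  "colors n = {0..<int n}"

definition color_of :: "nat \<Rightarrow> int \<Rightarrow> int" where
  "color_of n a = a mod int n"


section \<open>Marked colored partitions\<close>

text \<open>Rows are indexed from 0, boxes within a row from 1.\<close>

definition is_partition :: "(nat \<Rightarrow> nat) \<Rightarrow> bool" where
  "is_partition lam \<longleftrightarrow> antimono lam \<and> (\<exists>N. \<forall>i\<ge>N. lam i = 0)"

definition part_length :: "(nat \<Rightarrow> nat) \<Rightarrow> nat" where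
  "part_length lam = card {i. lam i > 0}"

definition colored_partition :: "nat \<Rightarrow> (nat \<Rightarrow> nat) \<Rightarrow> (nat \<Rightarrow> int) \<Rightarrow> bool" where
  "colored_partition n lam eps \<longleftrightarrow>
     is_partition lam \<and> (\<forall>i. eps i \<in> colors n) \<and> (\<forall>c\<in>colors n. infinite {i. eps i = c})"

definition signature :: "nat \<Rightarrow> (nat \<Rightarrow> nat) \<Rightarrow> (nat \<Rightarrow> int) \<Rightarrow> int \<Rightarrow> nat" where
  "signature n lam eps c =
     card {(i, j). 1 \<le> j \<and> j \<le> int (lam i) \<and> color_of n (eps i + (int (lam i) - j)) = c}"

definition is_marking :: "(nat \<Rightarrow> nat) \<Rightarrow> (nat \<Rightarrow> int) \<Rightarrow> bool" where
  "is_marking lam mu \<longleftrightarrow> (\<forall>i. mu i \<le> int (lam i))"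

definition comark :: "(nat \<Rightarrow> nat) \<Rightarrow> (nat \<Rightarrow> int) \<Rightarrow> nat \<Rightarrow> int" where
  "comark lam mu i = int (lam i) - mu i"

definition striped_bipartition ::
  "nat \<Rightarrow> (nat \<Rightarrow> nat) \<Rightarrow> (nat \<Rightarrow> int) \<Rightarrow> (nat \<Rightarrow> int) \<Rightarrow> bool" where
  "striped_bipartition n lam eps mu \<longleftrightarrow>
     colored_partition n lam eps \<and> is_marking lam mu \<and>
     (\<forall>i. mu i > - int n) \<and>
     (\<forall>i j. i < j \<longrightarrow> mu j < mu i + int n \<and> comark lam mu j < comark lam mu i + int n) \<and>
     (\<forall>i j. color_of n (eps i + comark lam mu i) = color_of n (eps j + comark lam mu j))"

type_synonym marked = "(nat \<Rightarrow> nat) \<times> (nat \<Rightarrow> int) \<times> (nat \<Rightarrow> int)"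

text \<open>
  The permutation ranges over all bijections of the set of rows, not only those of finite
  support: this is what identifies different colorings of the infinitely many empty rows.
\<close>

definition row_equiv :: "(marked \<times> marked) set" where
  "row_equiv = {((lam, eps, mu), (lam', eps', mu')).
     \<exists>p. bij p \<and> (\<forall>i. lam (p i) = lam i) \<and>
         lam' = lam \<circ> p \<and> eps' = eps \<circ> p \<and> mu' = mu \<circ> p}"


section \<open>Colored vector spaces\<close>

text \<open>The vector space is the whole type; \<open>V c\<close> is relevant only for \<open>c \<in> colors n\<close>.\<close>

locale colored_vector_space = vector_space scale
  for scale :: "'k::field \<Rightarrow> 'v::ab_group_add \<Rightarrow> 'v" +
  fixes n :: nat and V :: "int \<Rightarrow> 'v set"
  assumes n_pos: "n \<ge> 1"
    and finite_dim: "\<exists>B. finite B \<and> span B = UNIV"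
    and subspace_V: "c \<in> colors n \<Longrightarrow> subspace (V c)"
    and direct_sum: "\<exists>!f. f \<in> (\<Pi>\<^sub>E c\<in>colors n. V c) \<and> v = (\<Sum>c\<in>colors n. f c)"
begin

text \<open>
  An element of \<open>\<Prod>\<^sub>c GL(V\<^sub>c)\<close> is identified with the block-diagonal endomorphism
  of the whole space whose restrictions to the summands are its components.
\<close>

definition K :: "('v \<Rightarrow> 'v) set" where
  "K = {k. Vector_Spaces.linear scale scale k \<and> (\<forall>c\<in>colors n. bij_betw k (V c) (V c))}"

definition nilcone :: "('v \<Rightarrow> 'v) set" where
  "nilcone = {x. Vector_Spaces.linear scale scale x \<and> (\<exists>p. \<forall>v. (x ^^ p) v = 0) \<and>
     (\<forall>c\<in>colors n. x ` V c \<subseteq> V (color_of n (c + 1)))}"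

definition act :: "('v \<Rightarrow> 'v) \<Rightarrow> 'v \<times> ('v \<Rightarrow> 'v) \<Rightarrow> 'v \<times> ('v \<Rightarrow> 'v)" where
  "act k = (\<lambda>(v, x). (k v, k \<circ> x \<circ> inv k))"

definition K_orbit :: "'v \<times> ('v \<Rightarrow> 'v) \<Rightarrow> ('v \<times> ('v \<Rightarrow> 'v)) set" where
  "K_orbit a = (\<lambda>k. act k a) ` K"

text \<open>
  The second index of \<open>b\<close> ranges over all integers, with the convention that vectors of
  nonpositive second index vanish; this includes the condition that \<open>x\<close> kills \<open>b i 1\<close>.
\<close>

definition colored_Jordan_basis ::
  "('v \<Rightarrow> 'v) \<Rightarrow> (nat \<Rightarrow> nat) \<Rightarrow> (nat \<Rightarrow> int) \<Rightarrow> (nat \<Rightarrow> int \<Rightarrow> 'v) \<Rightarrow> bool" where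
  "colored_Jordan_basis x lam eps b \<longleftrightarrow>
     (let J = {(i, j). i < part_length lam \<and> 1 \<le> j \<and> j \<le> int (lam i)} in
       inj_on (\<lambda>(i, j). b i j) J \<and>
       independent ((\<lambda>(i, j). b i j) ` J) \<and> span ((\<lambda>(i, j). b i j) ` J) = UNIV \<and>
       (\<forall>(i, j)\<in>J. b i j \<in> V (color_of n (eps i + (int (lam i) - j))) \<and>
                   x (b i j) = b i (j - 1))) \<and>
     (\<forall>i<part_length lam. \<forall>j\<le>0. b i j = 0)"

definition has_signature :: "(nat \<Rightarrow> nat) \<Rightarrow> (nat \<Rightarrow> int) \<Rightarrow> bool" where
  "has_signature lam eps \<longleftrightarrow> (\<forall>c\<in>colors n. signature n lam eps c = dim (V c))"

definition Psi :: "marked \<Rightarrow> ('v \<times> ('v \<Rightarrow> 'v)) set" where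
  "Psi = (\<lambda>(lam, eps, mu). THE Orb. \<exists>x b.
     x \<in> nilcone \<and> colored_Jordan_basis x lam eps b \<and>
     Orb = K_orbit (\<Sum>i<part_length lam. b i (mu i), x))"

definition striped_bipartitions_over :: "int \<Rightarrow> marked set" where
  "striped_bipartitions_over m = {(lam, eps, mu).
     striped_bipartition n lam eps mu \<and> has_signature lam eps \<and>
     (\<forall>i. color_of n (eps i + (int (lam i) - mu i)) = m)}"

end

end

(*
  Surjectivity: among all families of homogeneous generators u_i of V as a k[x]-module with
  x^(l_i) u_i = 0, one with minimal sum of the l_i is a colored Jordan basis. After multiplying each
  u_i by a unit of k[x^n], v is the sum of the x^(nu_i) u_i; if the sum of the nu_i is minimal, the
  resulting marking is striped, since any violated inequality allows an exchange that lowers it.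

  Injectivity: for a striped n-bipartition, the images of v under the graded endomorphisms commuting
  with x span exactly the basis vectors v_(i,j) with j <= mu_i and j = mu_i mod n. Intersecting powers
  of x applied to this subspace with the images of powers of x, dimensions count the rows of given
  length and mark, and the color of a row is determined by its length, its mark and m. Equal counts
  give a permutation of the rows; the empty rows are matched because each color occurs infinitely
  often.
*)
theory Submission
  imports Defs "HOL-Library.Infinite_Set"
begin

section \<open>Colored vector spaces\<close>

text \<open>One inequality drives both halves. A graded endomorphism commuting with \<open>x\<close>
  carries the vector at the mark of row j into row i at height at most the minimum of
  \<open>mu_j\<close> and \<open>lam_i - nu_j\<close>, and within color m only at heights congruent
  to \<open>mu_i\<close> modulo n. That bound reaches \<open>mu_i + n\<close> exactly when
  \<open>mu_i + n \<le> mu_j\<close> and \<open>nu_j + n \<le> nu_i\<close>. When both hold, the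
  basis can be changed so that the mark of row i rises by n; when they never hold together, the
  congruence confines every image to heights at most \<open>mu_i\<close>, so the marks can be read
  off. The exchange excludes only the conjunction; sorting the rows by decreasing length turns this
  into two separate inequalities for i < j.

  A row of mark at most 0 contributes nothing to v, so no construction from v sees it. Its mark is
  forced into n consecutive values by \<open>mu_i > -n\<close> and then fixed by its color, so such
  rows are counted by the grading alone.

  The subspaces that are compared are built from v, x and the grading, without a Jordan basis. Hence
  the counts are invariants of the orbit, once a conjugating element has moved one of the two
  bases.\<close>

lemma ex_bij_betw_nat_sets:
  fixes A B :: "nat set"
  assumes "finite A \<longleftrightarrow> finite B" "card A = card B"
  shows "\<exists>h. bij_betw h A B"
proof (cases "finite A")
  case True
  then show ?thesis
    using assms finite_same_card_bij by blast
next
  case False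
  then have "bij_betw (Infinite_Set.enumerate A) UNIV A" "bij_betw (Infinite_Set.enumerate B) UNIV B"
    using assms by (auto intro: bij_enumerate)
  then show ?thesis
    using bij_betw_inv_into bij_betw_trans by blast
qed

text \<open>Bijections between fibres are glued: \<open>p\<close> sends \<open>i\<close> into the
  fibre of \<open>f\<close> over \<open>g i\<close>, and injectivity is checked within one fibre.
  With rows read as triples of length, color and mark, this yields the row permutation.\<close>

lemma ex_bij_comp_eq:
  fixes f g :: "nat \<Rightarrow> 'a"
  assumes "\<And>t. \<exists>h. bij_betw h {i. g i = t} {i. f i = t}"
  shows "\<exists>p. bij p \<and> g = f \<circ> p"
proof -
  obtain h where h: "\<And>t. bij_betw (h t) {i. g i = t} {i. f i = t}"
    using assms by metis
  define p where "p i = h (g i) i" for i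
  have fp: "f (p i) = g i" for i
    using bij_betw_apply[OF h[of "g i"], of i] by (simp add: p_def)
  have "inj p"
  proof (rule injI)
    fix i j assume eq: "p i = p j"
    then have "g i = g j"
      using fp by metis
    then show "i = j"
      using eq h[of "g i"] unfolding p_def bij_betw_def inj_on_def by auto
  qed
  moreover have "surj p"
  proof (unfold surj_def, intro allI)
    fix j
    have "j \<in> h (f j) ` {i. g i = f j}"
      using h[of "f j"] by (simp add: bij_betw_def)
    then obtain i where "g i = f j" "h (f j) i = j"
      by auto
    then show "\<exists>i. j = p i"
      unfolding p_def by metis
  qed
  ultimately show ?thesis
    using fp by (auto simp: bij_def fun_eq_iff intro!: exI[of _ p])
qed

context colored_vector_space
begin

abbreviation lin :: "('v \<Rightarrow> 'v) \<Rightarrow> bool" where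
  "lin \<equiv> Vector_Spaces.linear scale scale"

interpretation lp: vector_space_pair scale scale
  by unfold_locales

lemma color_in [simp]: "color_of n a \<in> colors n"
  using n_pos by (auto simp: color_of_def colors_def)

lemma color_of_color [simp]: "c \<in> colors n \<Longrightarrow> color_of n c = c"
  by (auto simp: color_of_def colors_def)

lemma color_of_add_left [simp]: "color_of n (color_of n a + b) = color_of n (a + b)"
  by (simp add: color_of_def mod_add_left_eq)

lemma color_of_diff_left [simp]: "color_of n (color_of n a - b) = color_of n (a - b)"
  by (simp add: color_of_def mod_diff_left_eq)

lemma finite_colors [simp]: "finite (colors n)"
  by (simp add: colors_def)

lemma component_zero:
  assumes f: "\<And>c. c \<in> colors n \<Longrightarrow> f c \<in> V c" and "(\<Sum>c\<in>colors n. f c) = 0" and "c \<in> colors n"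
  shows "f c = 0"
proof -
  let ?P = "\<lambda>g. g \<in> (\<Pi>\<^sub>E c\<in>colors n. V c) \<and> 0 = (\<Sum>c\<in>colors n. g c)"
  \<comment> \<open>Uniqueness in \<open>direct_sum\<close> concerns extensional functions, so both
    decompositions of 0 are restricted to the colors before they are compared.\<close>
  have "?P (restrict f (colors n))" "?P (restrict (\<lambda>_. 0) (colors n))"
    using f assms(2) subspace_0[OF subspace_V] by auto
  then have "restrict f (colors n) = restrict (\<lambda>_. 0) (colors n)"
    using direct_sum[of 0] by (blast elim: ex1E)
  then show ?thesis
    using assms(3) by (metis restrict_apply')
qed

lemma V_disjoint:
  assumes "v \<in> V c" "v \<in> V d" "c \<in> colors n" "d \<in> colors n" "c \<noteq> d"
  shows "v = 0"
proof -
  let ?f = "\<lambda>i. if i = c then v else if i = d then - v else 0"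
  have "(\<Sum>i\<in>colors n. ?f i) = (\<Sum>i\<in>{c, d}. ?f i)"
    using assms by (intro sum.mono_neutral_right) auto
  also have "\<dots> = 0"
    using assms by simp
  finally have sum: "(\<Sum>i\<in>colors n. ?f i) = 0" .
  have "?f i \<in> V i" if "i \<in> colors n" for i
    using assms subspace_0[OF subspace_V[OF that]] subspace_neg[OF subspace_V[OF that]] by auto
  from component_zero[OF this sum \<open>c \<in> colors n\<close>] have "?f c = 0" .
  then show ?thesis by simp
qed

text \<open>Grouped by color, the terms form a decomposition of 0, so each group vanishes. This
  serves to cut a linear relation down to terms of a single color.\<close>

lemma graded_sum_zero:
  assumes "finite I" and f: "\<And>i. i \<in> I \<Longrightarrow> e i \<in> colors n \<and> f i \<in> V (e i)"
    and 0: "(\<Sum>i\<in>I. f i) = 0" and c: "c \<in> colors n"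
  shows "(\<Sum>i\<in>{i\<in>I. e i = c}. f i) = 0"
proof (rule component_zero[of "\<lambda>c. \<Sum>i\<in>{i\<in>I. e i = c}. f i"])
  show "(\<Sum>c\<in>colors n. \<Sum>i\<in>{i\<in>I. e i = c}. f i) = 0"
    using assms sum.group[of I "colors n" e f] by auto
  show "(\<Sum>i\<in>{i\<in>I. e i = d}. f i) \<in> V d" if "d \<in> colors n" for d
    using f that by (intro subspace_sum subspace_V) auto
qed (rule c)

text \<open>The vectors whose components are spanned by elements of \<open>B\<close> in the same
  summand form a subspace containing \<open>B\<close>, hence everything. A vector of
  \<open>V c\<close> equals its own component at \<open>c\<close>, by uniqueness of
  components.\<close>

lemma V_eq_span:
  assumes B: "span B = UNIV" "B \<subseteq> (\<Union>c\<in>colors n. V c)" and c: "c \<in> colors n"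
  shows "V c = span (B \<inter> V c)"
proof
  show "span (B \<inter> V c) \<subseteq> V c"
    using c by (intro span_minimal subspace_V) auto
  define S where "S = {v. \<exists>f. (\<forall>d\<in>colors n. f d \<in> span (B \<inter> V d)) \<and> v = (\<Sum>d\<in>colors n. f d)}"
  have "subspace S"
  proof (rule subspaceI)
    show "0 \<in> S"
      unfolding S_def by (auto intro!: exI[of _ "\<lambda>_. 0"] span_zero)
  next
    fix v w assume "v \<in> S" "w \<in> S"
    then obtain f g where "\<forall>d\<in>colors n. f d \<in> span (B \<inter> V d)" "v = (\<Sum>d\<in>colors n. f d)"
      "\<forall>d\<in>colors n. g d \<in> span (B \<inter> V d)" "w = (\<Sum>d\<in>colors n. g d)"
      unfolding S_def by auto
    then show "v + w \<in> S"
      unfolding S_def by (auto intro!: exI[of _ "\<lambda>d. f d + g d"] span_add simp: sum.distrib)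
  next
    fix r v assume "v \<in> S"
    then obtain f where "\<forall>d\<in>colors n. f d \<in> span (B \<inter> V d)" "v = (\<Sum>d\<in>colors n. f d)"
      unfolding S_def by auto
    then show "scale r v \<in> S"
      unfolding S_def by (auto intro!: exI[of _ "\<lambda>d. scale r (f d)"] span_scale simp: scale_sum_right)
  qed
  moreover have "B \<subseteq> S"
  proof
    fix b assume "b \<in> B"
    then obtain d where "d \<in> colors n" "b \<in> V d"
      using B by auto
    then have "(\<forall>i\<in>colors n. (if i = d then b else 0) \<in> span (B \<inter> V i)) \<and>
        b = (\<Sum>i\<in>colors n. if i = d then b else 0)"
      using \<open>b \<in> B\<close> by (auto intro: span_base span_zero)
    then show "b \<in> S"
      unfolding S_def by (intro CollectI exI[of _ "\<lambda>i. if i = d then b else 0"])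
  qed
  ultimately have S: "S = UNIV"
    using span_minimal[of B S] B by auto
  show "V c \<subseteq> span (B \<inter> V c)"
  proof
    fix v assume v: "v \<in> V c"
    obtain f where f: "\<And>d. d \<in> colors n \<Longrightarrow> f d \<in> span (B \<inter> V d)" "v = (\<Sum>d\<in>colors n. f d)"
      using S unfolding S_def by blast
    have fV: "f d \<in> V d" if "d \<in> colors n" for d
      using f(1)[OF that] span_minimal[OF _ subspace_V[OF that], of "B \<inter> V d"] by auto
    let ?g = "\<lambda>d. f d - (if d = c then v else 0)"
    have "?g d \<in> V d" if "d \<in> colors n" for d
      using fV[OF that] v that by (auto intro: subspace_diff[OF subspace_V])
    moreover have "(\<Sum>d\<in>colors n. ?g d) = 0"
      using f(2) c by (simp add: sum_subtractf)
    ultimately have "?g c = 0"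
      using c by (rule component_zero)
    then show "v \<in> span (B \<inter> V c)"
      using f(1)[OF c] by simp
  qed
qed

section \<open>Finite dimension, and linear algebra with indexed families\<close>

lemma UNIV_eq_span_V: "span (\<Union>c\<in>colors n. V c) = UNIV"
proof -
  have "v \<in> span (\<Union>c\<in>colors n. V c)" for v
    using direct_sum[of v] by (elim ex1E) (auto intro!: span_sum intro: span_base)
  then show ?thesis by auto
qed

lemma ex_finite_basis:
  obtains B where "finite B" "independent B" "span B = UNIV"
proof -
  obtain B0 where B0: "finite B0" "span B0 = UNIV"
    using finite_dim by auto
  obtain B where B: "B \<subseteq> B0" "independent B" "B0 \<subseteq> span B"
    using maximal_independent_subset .
  then have "span B = UNIV"
    using span_minimal[OF B(3)] B0 by auto
  then show ?thesis
    using that[OF finite_subset[OF B(1) B0(1)] B(2)] by simp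
qed

lemma ex_finite_dimensional: "\<exists>B. finite_dimensional_vector_space scale B"
proof -
  obtain B where "finite B" "independent B" "span B = UNIV"
    using ex_finite_basis .
  then have "finite_dimensional_vector_space scale B"
    by unfold_locales
  then show ?thesis ..
qed

lemma finite_independent: "independent B \<Longrightarrow> finite B"
  using ex_finite_dimensional finite_dimensional_vector_space.finiteI_independent by blast

text \<open>Families are used instead of sets because different boxes might a priori carry the same
  vector; the count alone excludes this.\<close>

lemma spanning_family_independent:
  assumes "finite I" "span (f ` I) = UNIV" "card I \<le> dim UNIV"
  shows "inj_on f I" "independent (f ` I)"
proof -
  obtain Bs where "finite_dimensional_vector_space scale Bs"
    using ex_finite_dimensional ..
  then interpret fd: finite_dimensional_vector_space scale Bs .
  have "dim UNIV \<le> card (f ` I)"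
    using assms by (intro dim_le_card) auto
  then show "inj_on f I"
    using assms card_image_le[of I f] by (intro eq_card_imp_inj_on) auto
  show "independent (f ` I)"
    using assms card_image_le[of I f] by (intro fd.card_le_dim_spanning[of _ UNIV]) auto
qed

lemma family_relation:
  assumes "finite I" "dim UNIV < card I" 
  shows "\<exists>r. (\<exists>i\<in>I. r i \<noteq> 0) \<and> (\<Sum>i\<in>I. scale (r i) (f i)) = 0"
proof (cases "inj_on f I")
  case False
  then obtain i j where ij: "i \<in> I" "j \<in> I" "i \<noteq> j" "f i = f j"
    by (auto simp: inj_on_def)
  let ?r = "\<lambda>k. if k = i then 1 else if k = j then - 1 else (0 :: 'k)"
  have "(\<Sum>k\<in>I. scale (?r k) (f k)) = (\<Sum>k\<in>{i, j}. scale (?r k) (f k))"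
    using ij assms by (intro sum.mono_neutral_right) auto
  also have "\<dots> = 0"
    using ij by simp
  finally show ?thesis
    using ij by (intro exI[of _ ?r]) auto
next
  case True
  obtain Bs where "finite_dimensional_vector_space scale Bs"
    using ex_finite_dimensional ..
  then interpret fd: finite_dimensional_vector_space scale Bs .
  have "dependent (f ` I)"
    using assms card_image[OF True] fd.independent_card_le_dim[of "f ` I" UNIV] by fastforce
  then obtain r where "\<exists>v\<in>f ` I. r v \<noteq> 0" "(\<Sum>v\<in>f ` I. scale (r v) v) = 0"
    using dependent_finite[of "f ` I"] assms by auto
  then show ?thesis
    using sum.reindex[OF True, of "\<lambda>v. scale (r v) v"]
    by (intro exI[of _ "r \<circ> f"]) auto
qed

lemma family_sum_of_span:
  assumes "finite I" "v \<in> span (f ` I)"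
  shows "\<exists>r. v = (\<Sum>i\<in>I. scale (r i) (f i))"
proof -
  have "span (f ` I) \<subseteq> range (\<lambda>r. \<Sum>i\<in>I. scale (r i) (f i))"
  proof (rule span_minimal)
    show "f ` I \<subseteq> range (\<lambda>r. \<Sum>i\<in>I. scale (r i) (f i))"
    proof (clarify)
      fix i assume "i \<in> I"
      then have "f i = (\<Sum>j\<in>I. scale (if j = i then 1 else 0) (f j))"
        using assms(1) by (simp add: if_distrib[of "\<lambda>r. scale r _"] cong: if_cong)
      then show "f i \<in> range (\<lambda>r. \<Sum>i\<in>I. scale (r i) (f i))"
        by (rule range_eqI[where x = "\<lambda>j. if j = i then 1 else 0"])
    qed
    show "subspace (range (\<lambda>r. \<Sum>i\<in>I. scale (r i) (f i)))"
    proof (rule subspaceI; (clarsimp simp: image_iff)?)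
      show "\<exists>r. (\<Sum>i\<in>I. scale (r i) (f i)) = 0"
        by (rule exI[of _ "\<lambda>_. 0"]) simp
      show "\<exists>q. (\<Sum>i\<in>I. scale (r i) (f i)) + (\<Sum>i\<in>I. scale (s i) (f i)) = (\<Sum>i\<in>I. scale (q i) (f i))" for r s
        by (rule exI[of _ "\<lambda>i. r i + s i"]) (simp add: scale_left_distrib sum.distrib)
      show "\<exists>q. scale a (\<Sum>i\<in>I. scale (r i) (f i)) = (\<Sum>i\<in>I. scale (q i) (f i))" for a r
        by (rule exI[of _ "\<lambda>i. a * r i"]) (simp add: scale_sum_right)
    qed
  qed
  then show ?thesis
    using assms by auto
qed

lemma lin_id: "lin (\<lambda>v. v)"
  using module_hom_ident by (simp add: module_hom_iff_linear)

lemma lin_comp: "lin f \<Longrightarrow> lin g \<Longrightarrow> lin (f \<circ> g)"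
  using Vector_Spaces.linear_compose by blast

lemma lin_funpow: "lin f \<Longrightarrow> lin (f ^^ k)"
  by (induction k) (auto intro: lin_comp lin_id simp: id_def)

lemma lin_span_image: "lin f \<Longrightarrow> span (f ` A) = f ` span A"
  by (rule lp.linear_span_image)

lemma lin_eq_on_span:
  "lin f \<Longrightarrow> lin g \<Longrightarrow> (\<And>b. b \<in> B \<Longrightarrow> f b = g b) \<Longrightarrow> v \<in> span B \<Longrightarrow> f v = g v"
  by (rule lp.linear_eq_on_span)

lemmas lin_0 = lp.linear_0
lemmas lin_add = lp.linear_add
lemmas lin_diff = lp.linear_diff
lemmas lin_scale = lp.linear_scale
lemmas lin_sum = lp.linear_sum

lemma family_lin_extend:
  assumes "inj_on f I" "independent (f ` I)"
  shows "\<exists>g. lin g \<and> (\<forall>i\<in>I. g (f i) = h i)"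
proof -
  obtain g where "lin g" "\<forall>b\<in>f ` I. g b = (h \<circ> inv_into I f) b"
    using lp.linear_independent_extend[OF assms(2)] by blast
  then show ?thesis
    using assms(1) by (intro exI[of _ g]) auto
qed

text \<open>The coordinates of a common vector are supported in both subsets. This reduces
  intersections of subspaces spanned by basis vectors to intersections of index sets.\<close>

lemma span_Int_independent:
  assumes "independent B" "A \<subseteq> B" "C \<subseteq> B"
  shows "span A \<inter> span C = span (A \<inter> C)"
proof
  show "span A \<inter> span C \<subseteq> span (A \<inter> C)"
  proof
    fix v assume v: "v \<in> span A \<inter> span C"
    have "representation B v = representation A v" "representation B v = representation C v"
      using v assms representation_extend by blast+
    then have *: "{b. representation A v b \<noteq> 0} \<subseteq> A \<inter> C"
      using representation_ne_zero[of A v] representation_ne_zero[of C v] by auto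
    have "v = (\<Sum>b | representation A v b \<noteq> 0. scale (representation A v b) b)"
      using v independent_mono[OF assms(1,2)] by (simp add: sum_nonzero_representation_eq)
    also have "\<dots> \<in> span (A \<inter> C)"
      using * by (intro span_sum span_scale span_base) auto
    finally show "v \<in> span (A \<inter> C)" .
  qed
qed (simp add: span_mono)

end

section \<open>Generators of a graded nilpotent endomorphism\<close>

lemma funpow_funpow: "(f ^^ j) ((f ^^ k) w) = (f ^^ (j + k)) w"
  by (simp add: funpow_add)

locale graded_nilpotent = colored_vector_space scale n V
  for scale :: "'k::field \<Rightarrow> 'v::ab_group_add \<Rightarrow> 'v" and n :: nat and V :: "int \<Rightarrow> 'v set" +
  fixes x :: "'v \<Rightarrow> 'v"
  assumes x_nilcone: "x \<in> nilcone"
begin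

lemma lin_x: "lin x"
  using x_nilcone by (simp add: nilcone_def)

lemmas lin_xk = lin_funpow[OF lin_x]

lemma x_nilpotent: "\<exists>p. \<forall>v. (x ^^ p) v = 0"
  using x_nilcone by (simp add: nilcone_def)

lemma x_V: "v \<in> V c \<Longrightarrow> c \<in> colors n \<Longrightarrow> x v \<in> V (color_of n (c + 1))"
  using x_nilcone by (auto simp: nilcone_def)

lemma xk_V: "v \<in> V c \<Longrightarrow> c \<in> colors n \<Longrightarrow> (x ^^ k) v \<in> V (color_of n (c + int k))"
proof (induction k)
  case (Suc k)
  then show ?case
    using x_V[of "(x ^^ k) v" "color_of n (c + int k)"] by (simp add: add.assoc add.commute[of 1])
qed simp

lemma xk_zero_ge: "(x ^^ k) w = 0 \<Longrightarrow> k \<le> j \<Longrightarrow> (x ^^ j) w = 0"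
  using funpow_funpow[where f = x, of "j - k" k w] lin_0[OF lin_xk] by simp

text \<open>Iterating \<open>v = s + x w\<close> and using that \<open>S\<close> is stable under
  \<open>x\<close> puts every \<open>v\<close> into \<open>S\<close> plus the image of
  \<open>x ^^ k\<close> for all \<open>k\<close>; a large power of \<open>x\<close> is zero.\<close>

lemma nakayama:
  assumes S: "subspace S" "x ` S \<subseteq> S" and gen: "span (S \<union> range x) = UNIV"
  shows "S = UNIV"
proof -
  have step: "\<exists>s\<in>S. \<exists>w. v = s + x w" for v
  proof -
    have x: "span (range x) = range x"
      using lin_span_image[OF lin_x, of UNIV] unfolding span_UNIV .
    have S_span: "span S = S"
      using S(1) span_eq_iff by blast
    have "UNIV = {a + b |a b. a \<in> S \<and> b \<in> range x}"
      using span_Un[of S "range x"] unfolding gen x S_span .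
    then have "v \<in> {a + b |a b. a \<in> S \<and> b \<in> range x}"
      by blast
    then show ?thesis
      by auto
  qed
  have xk: "(x ^^ k) s \<in> S" if "s \<in> S" for k s
    using that S by (induction k) auto
  have "\<exists>w. v - (x ^^ k) w \<in> S" for v k
  proof (induction k)
    case 0
    show ?case
      using subspace_0[OF S(1)] by (intro exI[of _ v]) simp
  next
    case (Suc k)
    then obtain w where w: "v - (x ^^ k) w \<in> S" ..
    obtain s w' where s: "s \<in> S" "w = s + x w'"
      using step by blast
    have "v - (x ^^ Suc k) w' = (v - (x ^^ k) w) + (x ^^ k) s"
      using s(2) lin_add[OF lin_xk] by (simp add: funpow_swap1)
    then show ?case
      using subspace_add[OF S(1) w xk[OF s(1)]] by metis
  qed
  moreover obtain p where "\<forall>v. (x ^^ p) v = 0"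
    using x_nilpotent ..
  ultimately have "v \<in> S" for v
    by (metis diff_zero)
  then show ?thesis
    by auto
qed

section \<open>Homogeneous generators and their reduction to a basis\<close>

text \<open>Here \<open>l i\<close> is only an upper bound for the order of \<open>x\<close> on
  \<open>u i\<close>, and redundant or zero generators are allowed. So the number and the colors of
  the generators can stay fixed while \<open>l\<close> and \<open>u\<close> are improved.\<close>

definition generators :: "nat \<Rightarrow> (nat \<Rightarrow> nat) \<Rightarrow> (nat \<Rightarrow> int) \<Rightarrow> (nat \<Rightarrow> 'v) \<Rightarrow> bool" where
  "generators N l e u \<longleftrightarrow>
     (\<forall>i<N. e i \<in> colors n \<and> u i \<in> V (e i) \<and> (x ^^ l i) (u i) = 0) \<and>
     span (u ` {..<N} \<union> range x) = UNIV"

definition power_boxes :: "nat \<Rightarrow> (nat \<Rightarrow> nat) \<Rightarrow> (nat \<times> nat) set" where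
  "power_boxes N l = (SIGMA i:{..<N}. {..<l i})"

lemma finite_power_boxes [simp]: "finite (power_boxes N l)"
  by (simp add: power_boxes_def)

lemma card_power_boxes: "card (power_boxes N l) = (\<Sum>i<N. l i)"
  by (simp add: power_boxes_def)

lemma generators_span:
  assumes "generators N l e u"
  shows "span ((\<lambda>(i, a). (x ^^ a) (u i)) ` power_boxes N l) = UNIV" (is "span ?B = UNIV")
proof (rule nakayama)
  have xin: "(x ^^ a) (u i) \<in> span ?B" if "i < N" for i a
  proof (cases "a < l i")
    case True
    then show ?thesis
      using that by (intro span_base image_eqI[of _ _ "(i, a)"]) (auto simp: power_boxes_def)
  next
    case False
    then have "(x ^^ a) (u i) = 0"
      using that assms xk_zero_ge[of "l i"] by (auto simp: generators_def)
    then show ?thesis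
      by (simp add: span_zero)
  qed
  have "x ` ?B \<subseteq> span ?B"
    using xin[of _ "Suc _"] by (auto simp: power_boxes_def)
  then show "x ` span ?B \<subseteq> span ?B"
    using span_minimal[OF _ subspace_span] by (simp flip: lin_span_image[OF lin_x])
  have "u ` {..<N} \<subseteq> span ?B"
    using xin[of _ 0] by auto
  then have "span (u ` {..<N} \<union> range x) \<subseteq> span (span ?B \<union> range x)"
    by (intro span_mono) auto
  then show "span (span ?B \<union> range x) = UNIV"
    using assms by (auto simp: generators_def)
qed simp

lemma span_generators_replace:
  assumes "span (u ` {..<N} \<union> range x) = UNIV"
    and "\<And>i. i < N \<Longrightarrow> u i \<in> span (u' ` {..<N} \<union> range x)"
  shows "span (u' ` {..<N} \<union> range x) = UNIV"
proof -
  have "u ` {..<N} \<union> range x \<subseteq> span (u' ` {..<N} \<union> range x)"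
    using assms(2) by (auto intro: span_base)
  then show ?thesis
    using span_minimal[OF _ subspace_span] assms(1) by blast
qed

lemma ex_generators: "\<exists>N l e u. generators N l e u"
proof -
  obtain B where B: "B \<subseteq> (\<Union>c\<in>colors n. V c)" "independent B" "(\<Union>c\<in>colors n. V c) \<subseteq> span B"
    using maximal_independent_subset .
  have sp: "span B = UNIV"
    using span_minimal[OF B(3)] UNIV_eq_span_V by auto
  obtain h where h: "bij_betw h {0..<card B} B"
    using ex_bij_betw_nat_finite finite_independent[OF B(2)] by blast
  have "\<exists>c. c \<in> colors n \<and> h i \<in> V c" if "i < card B" for i
    using h that B(1) by (force simp: bij_betw_def)
  then obtain e where e: "\<And>i. i < card B \<Longrightarrow> e i \<in> colors n \<and> h i \<in> V (e i)"
    by metis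
  obtain p where p: "\<forall>v. (x ^^ p) v = 0"
    using x_nilpotent ..
  have "h ` {..<card B} = B"
    using h by (simp add: bij_betw_def atLeast0LessThan)
  then have "span (h ` {..<card B} \<union> range x) = UNIV"
    using span_mono[of B "h ` {..<card B} \<union> range x"] sp by auto
  then have "generators (card B) (\<lambda>_. p) e h"
    using e p by (simp add: generators_def)
  then show ?thesis
    by blast
qed

text \<open>
  A linear relation among the vectors \<open>x\<^sup>a u\<^sub>i\<close> is multiplied by a power of \<open>x\<close> until only
  the bottoms of some chains survive; the generator of the shortest of these chains can then be
  replaced by a combination of generators that is killed by a smaller power of \<open>x\<close>.
\<close>

lemma generators_shorten:
  assumes gen: "generators N l e u" and big: "dim UNIV < (\<Sum>i<N. l i)"
  shows "\<exists>l' u'. generators N l' e u' \<and> (\<Sum>i<N. l' i) < (\<Sum>i<N. l i)"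
proof -
  let ?I = "power_boxes N l"
  obtain r where r: "\<exists>b\<in>?I. r b \<noteq> 0"
    "(\<Sum>b\<in>?I. scale (r b) ((\<lambda>(i, a). (x ^^ a) (u i)) b)) = 0"
    using family_relation[of ?I "\<lambda>(i, a). (x ^^ a) (u i)"] big by (auto simp: card_power_boxes)
  define D where "D = {b \<in> ?I. r b \<noteq> 0}"
  \<comment> \<open>The largest distance of a term of the relation from the bottom of its chain:
    \<open>x ^^ t\<close> kills all terms nearer to the bottom and moves those at distance
    \<open>t\<close> onto the bottoms.\<close>
  define t where "t = Max ((\<lambda>(i, a). l i - 1 - a) ` D)"
  have D: "finite D" "D \<noteq> {}"
    using r by (auto simp: D_def)
  have t_ge: "l i - 1 - a \<le> t" if "(i, a) \<in> D" for i a
    unfolding t_def using D that by (intro Max_ge) (auto intro: image_eqI[of _ _ "(i, a)"])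
  define S where "S = {i. i < N \<and> t < l i \<and> r (i, l i - 1 - t) \<noteq> 0}"
  define c where "c i = r (i, l i - 1 - t)" for i
  have "t \<in> (\<lambda>(i, a). l i - 1 - a) ` D"
    unfolding t_def using D by (intro Max_in) auto
  then obtain i1 a1 where "(i1, a1) \<in> D" "t = l i1 - 1 - a1"
    by auto
  then have i1: "i1 \<in> S"
    by (auto simp: S_def D_def power_boxes_def)
  have finS: "finite S"
    by (simp add: S_def)
  have genD: "e i \<in> colors n" "u i \<in> V (e i)" "(x ^^ l i) (u i) = 0" if "i < N" for i
    using gen that by (auto simp: generators_def)
  have "0 = (x ^^ t) (\<Sum>b\<in>?I. scale (r b) ((\<lambda>(i, a). (x ^^ a) (u i)) b))"
    using lin_0[OF lin_xk] by (simp add: r(2))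
  also have "\<dots> = (\<Sum>b\<in>?I. scale (r b) ((\<lambda>(i, a). (x ^^ (t + a)) (u i)) b))"
    by (simp add: lin_sum[OF lin_xk] lin_scale[OF lin_xk] case_prod_beta funpow_funpow)
  also have "\<dots> = (\<Sum>b\<in>(\<lambda>i. (i, l i - 1 - t)) ` S. scale (r b) ((\<lambda>(i, a). (x ^^ (t + a)) (u i)) b))"
  proof (rule sum.mono_neutral_right)
    show "\<forall>b\<in>?I - (\<lambda>i. (i, l i - 1 - t)) ` S. scale (r b) ((\<lambda>(i, a). (x ^^ (t + a)) (u i)) b) = 0"
    proof clarify
      fix i a assume ia: "(i, a) \<in> ?I" "(i, a) \<notin> (\<lambda>i. (i, l i - 1 - t)) ` S"
      then have i: "i < N" "a < l i"
        by (auto simp: power_boxes_def)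
      show "scale (r (i, a)) ((x ^^ (t + a)) (u i)) = 0"
      proof (cases "r (i, a) = 0")
        case False
        then have le: "l i - 1 - a \<le> t"
          using ia t_ge by (auto simp: D_def)
        have "l i \<le> t + a"
        proof (rule ccontr)
          assume "\<not> l i \<le> t + a"
          then have "a = l i - 1 - t" "t < l i"
            using le i by auto
          then have "i \<in> S"
            using False i by (auto simp: S_def)
          with \<open>a = l i - 1 - t\<close> ia(2) show False
            by auto
        qed
        then show ?thesis
          using genD(3)[OF i(1)] xk_zero_ge by auto
      qed simp
    qed
  qed (auto simp: S_def power_boxes_def)
  also have "\<dots> = (\<Sum>i\<in>S. scale (c i) ((x ^^ (l i - 1)) (u i)))"
    by (subst sum.reindex) (auto simp: inj_on_def c_def S_def intro!: sum.cong)
  finally have rel: "(\<Sum>i\<in>S. scale (c i) ((x ^^ (l i - 1)) (u i))) = 0"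
    by simp
  define col where "col i = color_of n (e i + int (l i - 1))" for i
  \<comment> \<open>The bottoms may have several colors; keeping one color makes the new generator
    homogeneous.\<close>
  define S' where "S' = {i \<in> S. col i = col i1}"
  have rel': "(\<Sum>i\<in>S'. scale (c i) ((x ^^ (l i - 1)) (u i))) = 0"
    unfolding S'_def
  proof (rule graded_sum_zero[OF finS _ rel])
    show "col i \<in> colors n \<and> scale (c i) ((x ^^ (l i - 1)) (u i)) \<in> V (col i)" if "i \<in> S" for i
      unfolding col_def using that genD[of i] xk_V
      by (intro conjI subspace_scale subspace_V color_in) (auto simp: S_def simp del: of_nat_diff)
  qed (simp add: col_def)
  obtain i0 where i0: "i0 \<in> S'" and i0_min: "\<And>i. i \<in> S' \<Longrightarrow> l i0 \<le> l i"
    using ex_has_least_nat[of "\<lambda>i. i \<in> S'" i1 l] i1 by (auto simp: S'_def)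
  have i0N: "i0 < N" "0 < l i0" "c i0 \<noteq> 0"
    using i0 by (auto simp: S'_def S_def c_def)
  \<comment> \<open>The relation divided by \<open>x ^^ (l i0 - 1)\<close>: that power sends
    \<open>u0\<close> to the relation, hence to 0. Minimality of \<open>l i0\<close> makes the
    division possible in every term.\<close>
  define u0 where "u0 = (\<Sum>i\<in>S'. scale (c i) ((x ^^ (l i - l i0)) (u i)))"
  define u' where "u' = u(i0 := u0)"
  define l' where "l' = l(i0 := l i0 - 1)"
  have finS': "finite S'"
    using finS by (simp add: S'_def)
  have "u0 \<in> V (e i0)"
    unfolding u0_def
  proof (rule subspace_sum)
    show "subspace (V (e i0))"
      using genD i0N by (intro subspace_V) auto
    fix i assume i: "i \<in> S'"
    then have iN: "i < N" "0 < l i" and cc: "col i = col i0"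
      using i0 by (auto simp: S'_def S_def)
    have "e i + int (l i - l i0) = (e i + int (l i - 1)) + (1 - int (l i0))"
      using i0_min[OF i] iN by (simp add: of_nat_diff)
    then have "color_of n (e i + int (l i - l i0)) = color_of n (col i + (1 - int (l i0)))"
      by (simp only: col_def color_of_add_left)
    also have "\<dots> = color_of n (e i0 + int (l i0 - 1) + (1 - int (l i0)))"
      unfolding cc by (simp only: col_def color_of_add_left)
    also have "\<dots> = color_of n (e i0)"
      using i0N by (simp add: of_nat_diff)
    finally have "color_of n (e i + int (l i - l i0)) = e i0"
      using genD i0N by simp
    then have "(x ^^ (l i - l i0)) (u i) \<in> V (e i0)"
      using xk_V[OF genD(2,1)[OF iN(1)]] by metis
    then show "scale (c i) ((x ^^ (l i - l i0)) (u i)) \<in> V (e i0)"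
      using genD i0N by (intro subspace_scale subspace_V) auto
  qed
  moreover have "(x ^^ (l i0 - 1)) u0 = 0"
  proof -
    have "(x ^^ (l i0 - 1)) u0 = (\<Sum>i\<in>S'. scale (c i) ((x ^^ (l i - 1)) (u i)))"
      unfolding u0_def lin_sum[OF lin_xk] lin_scale[OF lin_xk] funpow_funpow
      using i0_min i0N by (intro sum.cong) auto
    then show ?thesis
      using rel' by simp
  qed
  moreover have "span (u' ` {..<N} \<union> range x) = UNIV"
  proof (rule span_generators_replace)
    show "span (u ` {..<N} \<union> range x) = UNIV"
      using gen by (simp add: generators_def)
    let ?T = "span (u' ` {..<N} \<union> range x)"
    fix i assume i: "i < N"
    have other: "u k \<in> ?T" if "k < N" "k \<noteq> i0" for k
      using that by (intro span_base UnI1 image_eqI[of _ _ k]) (auto simp: u'_def)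
    show "u i \<in> ?T"
    proof (cases "i = i0")
      case True
      \<comment> \<open>A chain as short as that of \<open>i0\<close> contributes an unchanged
        generator, a longer one an element of the image of \<open>x\<close>; so \<open>u i0\<close>
        is recovered from \<open>u0\<close> after division by \<open>c i0\<close>.\<close>
      have "(x ^^ (l k - l i0)) (u k) \<in> ?T" if "k \<in> S' - {i0}" for k
      proof (cases "l k - l i0")
        case 0
        then show ?thesis
          using that other by (auto simp: S'_def S_def)
      next
        case (Suc d)
        then show ?thesis
          by (auto intro: span_base)
      qed
      then have "(\<Sum>k\<in>S' - {i0}. scale (c k) ((x ^^ (l k - l i0)) (u k))) \<in> ?T"
        by (intro span_sum span_scale) auto
      moreover have "u0 \<in> ?T"
        using i0N by (intro span_base UnI1 image_eqI[of _ _ i0]) (auto simp: u'_def)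
      moreover have "scale (c i0) (u i0) =
          u0 - (\<Sum>k\<in>S' - {i0}. scale (c k) ((x ^^ (l k - l i0)) (u k)))"
        unfolding u0_def using finS' i0 by (subst sum.remove[of S' i0]) auto
      ultimately have "scale (c i0) (u i0) \<in> ?T"
        by (simp add: span_diff)
      then have "scale (inverse (c i0)) (scale (c i0) (u i0)) \<in> ?T"
        by (rule span_scale)
      then show ?thesis
        using i0N True by simp
    qed (use other i in auto)
  qed
  ultimately have "generators N l' e u'"
    using genD by (auto simp: generators_def u'_def l'_def)
  moreover have "(\<Sum>i<N. l' i) < (\<Sum>i<N. l i)"
    using i0N by (intro sum_strict_mono_ex1) (auto simp: l'_def)
  ultimately show ?thesis
    by blast
qed

text \<open>Descent on the total length. This bound is what independence requires: the vectors of
  the chains span, and a spanning family with at most \<open>dim UNIV\<close> members is a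
  basis.\<close>

lemma ex_generators_basis: "\<exists>N l e u. generators N l e u \<and> (\<Sum>i<N. l i) \<le> dim UNIV"
proof -
  obtain N l e u where "generators N l e u"
    using ex_generators by blast
  then show ?thesis
  proof (induction "\<Sum>i<N. l i" arbitrary: l u rule: less_induct)
    case less
    show ?case
    proof (cases "(\<Sum>i<N. l i) \<le> dim UNIV")
      case False
      then show ?thesis
        using generators_shorten[OF less.prems] less.hyps by (meson not_le)
    qed (use less.prems in blast)
  qed
qed

section \<open>Normal form of the vector with respect to the generators\<close>

text \<open>The exponent \<open>nu i\<close> plays the role of the comark and has no upper bound
  here. Once it reaches \<open>l i\<close>, the term of row \<open>i\<close> is zero and the
  exponent only records a nonpositive mark.\<close>

definition adapted ::
    "nat \<Rightarrow> (nat \<Rightarrow> nat) \<Rightarrow> (nat \<Rightarrow> int) \<Rightarrow> int \<Rightarrow> 'v \<Rightarrow> (nat \<Rightarrow> nat) \<Rightarrow> (nat \<Rightarrow> 'v) \<Rightarrow> bool" where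
  "adapted N l e m v nu u \<longleftrightarrow> generators N l e u \<and> v = (\<Sum>i<N. (x ^^ nu i) (u i)) \<and>
     (\<forall>i<N. color_of n (e i + int (nu i)) = m)"

text \<open>A chain vector lying in \<open>V m\<close> without having color \<open>m\<close> is
  zero, so its coefficient may be dropped. The color clause confines the exponents in each row to
  one class modulo \<open>n\<close>.\<close>

lemma V_expansion:
  assumes gen: "generators N l e u" and v: "v \<in> V m" "m \<in> colors n"
  shows "\<exists>r. v = (\<Sum>i<N. \<Sum>a<l i. scale (r i a) ((x ^^ a) (u i))) \<and>
    (\<forall>i<N. \<forall>a. r i a \<noteq> 0 \<longrightarrow> color_of n (e i + int a) = m)"
proof -
  let ?f = "\<lambda>(i, a). (x ^^ a) (u i)"
  let ?I = "power_boxes N l"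
  define J where "J = {(i, a) \<in> ?I. color_of n (e i + int a) = m}"
  have fV: "(x ^^ a) (u i) \<in> V (color_of n (e i + int a))" if "i < N" for i a
    using gen that by (auto simp: generators_def intro: xk_V)
  then have "?f ` ?I \<subseteq> (\<Union>c\<in>colors n. V c)"
    by (force simp: power_boxes_def)
  from V_eq_span[OF generators_span[OF gen] this v(2)] have "v \<in> span (?f ` ?I \<inter> V m)"
    using v by simp
  also have "\<dots> \<subseteq> span (insert 0 (?f ` J))"
  proof (rule span_mono, clarify)
    fix i a assume ia: "(i, a) \<in> ?I" "(x ^^ a) (u i) \<in> V m" "(x ^^ a) (u i) \<notin> ?f ` J"
    then have "(i, a) \<notin> J"
      by force
    then have "color_of n (e i + int a) \<noteq> m" "i < N"
      using ia by (auto simp: J_def power_boxes_def)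
    then show "(x ^^ a) (u i) = 0"
      using V_disjoint[OF ia(2) fV[of i a]] v(2) by simp
  qed
  finally have "v \<in> span (?f ` J)"
    by simp
  moreover have "finite J"
    by (rule finite_subset[of _ ?I]) (auto simp: J_def)
  ultimately obtain r where r: "v = (\<Sum>b\<in>J. scale (r b) (?f b))"
    using family_sum_of_span by blast
  let ?r = "\<lambda>i a. if (i, a) \<in> J then r (i, a) else 0"
  have "v = (\<Sum>b\<in>?I. scale (case b of (i, a) \<Rightarrow> ?r i a) (?f b))"
    unfolding r by (rule sum.mono_neutral_cong_left) (auto simp: J_def split: if_splits)
  also have "\<dots> = (\<Sum>i<N. \<Sum>a<l i. scale (?r i a) ((x ^^ a) (u i)))"
    unfolding power_boxes_def by (subst sum.Sigma) (auto simp: case_prod_beta)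
  finally have "v = (\<Sum>i<N. \<Sum>a<l i. scale (?r i a) ((x ^^ a) (u i)))" .
  moreover have "color_of n (e i + int a) = m" if "?r i a \<noteq> 0" for i a
  proof -
    have "(i, a) \<in> J"
      using that by presburger
    then show ?thesis
      by (simp add: J_def)
  qed
  ultimately show ?thesis
    by (intro exI[of _ ?r]) simp
qed

text \<open>The lowest occurring power of \<open>x\<close> is factored out of the part of the vector
  on one chain. All exponents are congruent modulo \<open>n\<close>, so the cofactor is a polynomial
  in \<open>x ^^ n\<close> and \<open>w\<close> keeps the color of \<open>u\<close>. Its constant
  term is nonzero; the clause with \<open>k\<close> and \<open>z\<close> records this, so that
  \<open>w\<close> can replace \<open>u\<close> modulo the image of \<open>x\<close>.\<close>

lemma chain_normal_form:
  assumes u: "u \<in> V e" "e \<in> colors n" "(x ^^ l) u = 0" and m: "m \<in> colors n"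
    and r: "\<And>a. r a \<noteq> 0 \<Longrightarrow> color_of n (e + int a) = m"
  shows "\<exists>nu w. w \<in> V e \<and> (x ^^ l) w = 0 \<and> (\<exists>k z. k \<noteq> 0 \<and> w = scale k u + x z) \<and>
    color_of n (e + int nu) = m \<and> (x ^^ nu) w = (\<Sum>a<l. scale (r a) ((x ^^ a) u))"
proof (cases "\<exists>a<l. r a \<noteq> 0")
  case False
  \<comment> \<open>When the chain carries no part of the vector, every exponent from
    \<open>l\<close> on gives 0; this is the least one of the color required.\<close>
  let ?nu = "l + nat ((m - e - int l) mod int n)"
  have "e + int ?nu = e + int l + (m - e - int l) mod int n"
    using n_pos by simp
  then have "color_of n (e + int ?nu) = (e + int l + (m - e - int l)) mod int n"
    by (simp only: color_of_def mod_add_right_eq)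
  then have "color_of n (e + int ?nu) = m"
    using m by (simp add: colors_def)
  moreover have "(x ^^ ?nu) u = 0"
    using u(3) by (rule xk_zero_ge) simp
  moreover have "\<exists>k z. k \<noteq> 0 \<and> u = scale k u + x z"
    by (rule exI[of _ 1], rule exI[of _ 0]) (simp add: lin_0[OF lin_x])
  moreover have "(\<Sum>a<l. scale (r a) ((x ^^ a) u)) = 0"
    using False by (intro sum.neutral) auto
  ultimately show ?thesis
    using u by metis
next
  case True
  define nu where "nu = (LEAST a. a < l \<and> r a \<noteq> 0)"
  have nu: "nu < l" "r nu \<noteq> 0"
    using LeastI_ex[OF True] by (auto simp: nu_def)
  have nu_le: "nu \<le> a" if "a < l" "r a \<noteq> 0" for a
    unfolding nu_def using that by (intro Least_le) auto
  define A where "A = {a. a < l \<and> r a \<noteq> 0}"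
  have A: "finite A" "nu \<in> A"
    using nu by (auto simp: A_def)
  define w where "w = (\<Sum>a\<in>A. scale (r a) ((x ^^ (a - nu)) u))"
  have "w \<in> V e"
    unfolding w_def
  proof (intro subspace_sum subspace_scale subspace_V u)
    fix a assume a: "a \<in> A"
    have "color_of n (e + int (a - nu)) = color_of n (color_of n (e + int a) + (- int nu))"
      using a nu_le[of a] by (simp add: A_def algebra_simps)
    also have "\<dots> = color_of n (color_of n (e + int nu) + (- int nu))"
      using r[of a] r[of nu] a nu by (simp add: A_def)
    also have "\<dots> = e"
      using u by simp
    finally show "(x ^^ (a - nu)) u \<in> V e"
      using xk_V[OF u(1,2)] by metis
  qed
  moreover have "(x ^^ l) w = 0"
    unfolding w_def lin_sum[OF lin_xk] lin_scale[OF lin_xk] funpow_funpow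
    using u(3) xk_zero_ge by (intro sum.neutral) auto
  moreover have "w = scale (r nu) u + x (\<Sum>a\<in>A - {nu}. scale (r a) ((x ^^ (a - nu - 1)) u))"
  proof -
    have "x (\<Sum>a\<in>A - {nu}. scale (r a) ((x ^^ (a - nu - 1)) u)) =
        (\<Sum>a\<in>A - {nu}. scale (r a) ((x ^^ (a - nu)) u))"
      unfolding lin_sum[OF lin_x] lin_scale[OF lin_x]
    proof (rule sum.cong)
      fix a assume "a \<in> A - {nu}"
      then have "a - nu = Suc (a - nu - 1)"
        using nu_le[of a] by (auto simp: A_def)
      then show "scale (r a) (x ((x ^^ (a - nu - 1)) u)) = scale (r a) ((x ^^ (a - nu)) u)"
        by (metis comp_apply funpow.simps(2))
    qed simp
    then show ?thesis
      unfolding w_def using A by (subst sum.remove[of A nu]) auto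
  qed
  moreover have "(x ^^ nu) w = (\<Sum>a<l. scale (r a) ((x ^^ a) u))"
  proof -
    have "(x ^^ nu) w = (\<Sum>a\<in>A. scale (r a) ((x ^^ a) u))"
      unfolding w_def lin_sum[OF lin_xk] lin_scale[OF lin_xk] funpow_funpow
      using nu_le by (intro sum.cong) (auto simp: A_def)
    also have "\<dots> = (\<Sum>a<l. scale (r a) ((x ^^ a) u))"
      by (rule sum.mono_neutral_left) (auto simp: A_def)
    finally show ?thesis .
  qed
  ultimately have "w \<in> V e \<and> (x ^^ l) w = 0 \<and> (\<exists>k z. k \<noteq> 0 \<and> w = scale k u + x z) \<and>
      color_of n (e + int nu) = m \<and> (x ^^ nu) w = (\<Sum>a<l. scale (r a) ((x ^^ a) u))"
    using nu(2) r[of nu] by fast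
  then show ?thesis
    by blast
qed

lemma ex_adapted:
  assumes gen: "generators N l e u" and v: "v \<in> V m" "m \<in> colors n"
  shows "\<exists>nu w. adapted N l e m v nu w"
proof -
  obtain r where r: "v = (\<Sum>i<N. \<Sum>a<l i. scale (r i a) ((x ^^ a) (u i)))"
    "\<And>i a. i < N \<Longrightarrow> r i a \<noteq> 0 \<Longrightarrow> color_of n (e i + int a) = m"
    using V_expansion[OF assms] by blast
  define Q where "Q i nu w \<longleftrightarrow> w \<in> V (e i) \<and> (x ^^ l i) w = 0 \<and>
      (\<exists>k z. k \<noteq> 0 \<and> w = scale k (u i) + x z) \<and> color_of n (e i + int nu) = m \<and>
      (x ^^ nu) w = (\<Sum>a<l i. scale (r i a) ((x ^^ a) (u i)))" for i nu w
  have "\<exists>nu w. Q i nu w" if "i < N" for i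
    unfolding Q_def using gen r(2)[OF that] that v(2)
    by (intro chain_normal_form) (auto simp: generators_def)
  then obtain nu w where "\<And>i. i < N \<Longrightarrow> Q i (nu i) (w i)"
    by metis
  note w = this[unfolded Q_def]
  have "span (w ` {..<N} \<union> range x) = UNIV"
  proof (rule span_generators_replace)
    fix i assume i: "i < N"
    obtain k z where k: "k \<noteq> 0" "w i = scale k (u i) + x z"
      using w[OF i] by blast
    have "w i - x z \<in> span (w ` {..<N} \<union> range x)"
      using i by (intro span_diff span_base) auto
    then have "scale (inverse k) (w i - x z) \<in> span (w ` {..<N} \<union> range x)"
      by (rule span_scale)
    then show "u i \<in> span (w ` {..<N} \<union> range x)"
      using k by simp
  qed (use gen in \<open>simp add: generators_def\<close>)
  moreover have "v = (\<Sum>i<N. (x ^^ nu i) (w i))"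
    unfolding r(1) by (rule sum.cong) (auto simp: w)
  ultimately have "adapted N l e m v nu w"
    using w gen by (auto simp: adapted_def generators_def)
  then show ?thesis
    by blast
qed

lemma color_of_minus_n [simp]: "color_of n (a - int n) = color_of n a"
  by (simp add: color_of_def)

text \<open>Both exponents annihilate \<open>u i\<close>, so \<open>v\<close> does not change. If
  the sum of the exponents is minimal this move is impossible, which bounds the mark of every row
  below by \<open>-n\<close>, strictly.\<close>

lemma adapted_decrease_zero:
  assumes ad: "adapted N l e m v nu u" and i: "i < N" "l i + n \<le> nu i"
  shows "adapted N l e m v (nu(i := nu i - n)) u"
proof -
  have "(x ^^ nu i) (u i) = 0" "(x ^^ (nu i - n)) (u i) = 0"
    using ad i xk_zero_ge[of "l i" "u i"] by (auto simp: adapted_def generators_def)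
  then have "(\<Sum>k<N. (x ^^ nu k) (u k)) = (\<Sum>k<N. (x ^^ (nu(i := nu i - n)) k) (u k))"
    by (intro sum.cong) auto
  moreover have "color_of n (e i + int (nu i - n)) = m"
    using ad i color_of_minus_n[of "e i + int (nu i)"]
    by (auto simp: adapted_def of_nat_diff algebra_simps)
  ultimately show ?thesis
    using ad by (auto simp: adapted_def)
qed

text \<open>
  Replacing \<open>u\<^sub>i\<close> by \<open>u\<^sub>i + x\<^sup>n u\<^sub>i\<close> and \<open>u\<^sub>j\<close> by \<open>u\<^sub>j - x\<^sup>d u\<^sub>i\<close> leaves \<open>v\<close> unchanged while the
  mark of row \<open>i\<close> grows by \<open>n\<close>. So the striped form is the one with the largest possible marks, and
  rows on which \<open>v\<close> vanishes also carry a maximal (nonpositive) mark.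
\<close>

lemma adapted_exchange:
  assumes ad: "adapted N l e m v nu u" and ij: "i < N" "j < N" "i \<noteq> j"
    and le: "nu j + n \<le> nu i" "l i + nu j + n \<le> l j + nu i"
  shows "\<exists>u'. adapted N l e m v (nu(i := nu i - n)) u'"
proof -
  \<comment> \<open>Chosen so that \<open>nu j + d = nu i - n\<close>: then
    \<open>x ^^ (nu i - n)\<close> applied to \<open>u i\<close> enters \<open>v\<close> once with
    each sign. The second inequality in \<open>le\<close> says \<open>l i \<le> l j + d\<close>, so
    \<open>x ^^ l j\<close> also kills the new \<open>u j\<close>.\<close>
  define d where "d = nu i - n - nu j"
  define u' where "u' = u(i := u i + (x ^^ n) (u i), j := u j - (x ^^ d) (u i))"
  have u'_simps [simp]: "u' i = u i + (x ^^ n) (u i)" "u' j = u j - (x ^^ d) (u i)"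
    "\<And>k. k \<noteq> i \<Longrightarrow> k \<noteq> j \<Longrightarrow> u' k = u k"
    using ij by (auto simp: u'_def)
  have genD: "e k \<in> colors n" "u k \<in> V (e k)" "(x ^^ l k) (u k) = 0"
    "color_of n (e k + int (nu k)) = m" if "k < N" for k
    using ad that by (auto simp: adapted_def generators_def)
  have "color_of n (e i + int n) = e i"
    using genD[OF ij(1)] color_of_minus_n[of "e i + int n"] by simp
  then have "(x ^^ n) (u i) \<in> V (e i)"
    using xk_V[OF genD(2,1)[OF ij(1)]] by metis
  then have Vi: "u' i \<in> V (e i)"
    using genD[OF ij(1)] by (simp add: subspace_add subspace_V)
  have "e i + int d = (e i + int (nu i)) + (- int (nu j)) - int n"
    using le by (simp add: d_def of_nat_diff)
  then have "color_of n (e i + int d) = color_of n (color_of n (e i + int (nu i)) + (- int (nu j)))"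
    by (simp only: color_of_minus_n color_of_add_left)
  also have "\<dots> = color_of n (color_of n (e j + int (nu j)) + (- int (nu j)))"
    using genD(4) ij by simp
  also have "\<dots> = color_of n (e j + int (nu j) + (- int (nu j)))"
    by (simp only: color_of_add_left)
  also have "\<dots> = e j"
    using genD(1)[OF ij(2)] by simp
  finally have "(x ^^ d) (u i) \<in> V (e j)"
    using xk_V[OF genD(2,1)[OF ij(1)]] by metis
  then have Vj: "u' j \<in> V (e j)"
    using genD[OF ij(2)] by (simp add: subspace_diff subspace_V)
  have zi: "(x ^^ l i) (u' i) = 0"
    using genD(3)[OF ij(1)] xk_zero_ge[of "l i" "u i" "l i + n"]
    by (simp add: lin_add[OF lin_xk] funpow_funpow)
  have zj: "(x ^^ l j) (u' j) = 0"
    using genD(3) ij le xk_zero_ge[of "l i" "u i" "l j + d"]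
    by (simp add: lin_diff[OF lin_xk] funpow_funpow d_def)
  have "span (u' ` {..<N} \<union> range x) = UNIV"
  proof (rule span_generators_replace)
    let ?T = "span (u' ` {..<N} \<union> range x)"
    have in_T: "u' k \<in> ?T" if "k < N" for k
      using that by (intro span_base) auto
    have x_T: "x z \<in> ?T" for z
      by (intro span_base) auto
    have n_Suc: "n = Suc (n - 1)"
      using n_pos by simp
    \<comment> \<open>Since \<open>n\<close> is positive this lies in the image of \<open>x\<close>,
      so \<open>u i\<close> is recovered first. The order matters for \<open>d = 0\<close>, where
      \<open>u' j\<close> contains \<open>u i\<close> itself.\<close>
    have "(x ^^ n) (u i) \<in> ?T"
      by (subst n_Suc) (simp add: x_T)
    from span_diff[OF in_T[OF ij(1)] this] have ui: "u i \<in> ?T"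
      by simp
    have "(x ^^ d) (u i) \<in> ?T"
      using ui x_T by (cases d) auto
    from span_add[OF in_T[OF ij(2)] this] have uj: "u j \<in> ?T"
      by simp
    show "u k \<in> ?T" if "k < N" for k
      using ui uj in_T[OF that] by (cases "k = i"; cases "k = j") auto
  qed (use ad in \<open>simp add: adapted_def generators_def\<close>)
  then have "generators N l e u'"
    using genD Vi Vj zi zj unfolding generators_def by (metis u'_simps(3))
  moreover have "v = (\<Sum>k<N. (x ^^ (nu(i := nu i - n)) k) (u' k))"
  proof -
    have eq: "(x ^^ (nu i - n)) (u' i) + (x ^^ nu j) (u' j) = (x ^^ nu i) (u i) + (x ^^ nu j) (u j)"
      using le by (simp add: lin_add[OF lin_xk] lin_diff[OF lin_xk] funpow_funpow d_def)
    have split: "(\<Sum>k<N. f k) = (\<Sum>k\<in>{..<N} - {i, j}. f k) + (f i + f j)" for f :: "nat \<Rightarrow> 'v"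
      using ij sum.subset_diff[of "{i, j}" "{..<N}" f] by simp
    have "v = (\<Sum>k<N. (x ^^ nu k) (u k))"
      using ad by (simp add: adapted_def)
    then show ?thesis
      unfolding split using eq ij by (auto intro!: sum.cong)
  qed
  moreover have "color_of n (e i + int (nu i - n)) = m"
    using genD(4)[OF ij(1)] le color_of_minus_n[of "e i + int (nu i)"]
    by (auto simp: of_nat_diff algebra_simps)
  ultimately show ?thesis
    using genD(4) by (auto simp: adapted_def)
qed

text \<open>With marks \<open>l i - nu i\<close>, the second alternative says that the mark of
  \<open>j\<close> is less than the mark of \<open>i\<close> plus \<open>n\<close>. An exchange
  requires both alternatives to fail, so minimality gives only a disjunction as long as the lengths
  are not ordered.\<close>

lemma ex_adapted_striped:
  assumes "adapted N l e m v nu0 u0"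
  shows "\<exists>nu u. adapted N l e m v nu u \<and> (\<forall>i<N. nu i < l i + n) \<and>
    (\<forall>i<N. \<forall>j<N. i \<noteq> j \<longrightarrow> nu i < nu j + n \<or> l j + nu i < l i + nu j + n)"
proof -
  obtain nu where nu: "\<exists>u. adapted N l e m v nu u"
    "\<And>nu'. \<exists>u. adapted N l e m v nu' u \<Longrightarrow> (\<Sum>i<N. nu i) \<le> (\<Sum>i<N. nu' i)"
    using ex_has_least_nat[of "\<lambda>nu. \<exists>u. adapted N l e m v nu u" nu0 "\<lambda>nu. \<Sum>i<N. nu i"] assms
    by blast
  obtain u where u: "adapted N l e m v nu u"
    using nu(1) ..
  have "False" if "i < N" "n \<le> nu i" "\<exists>u. adapted N l e m v (nu(i := nu i - n)) u" for i
  proof -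
    have "(\<Sum>k<N. (nu(i := nu i - n)) k) < (\<Sum>k<N. nu k)"
      using that n_pos by (intro sum_strict_mono_ex1) auto
    then show False
      using nu(2)[OF that(3)] by simp
  qed
  then show ?thesis
    using u adapted_decrease_zero[OF u] adapted_exchange[OF u]
    by (intro exI[of _ nu] exI[of _ u] conjI allI impI) (meson add_leE not_le)+
qed

end

section \<open>Colored Jordan bases\<close>

text \<open>The nonempty rows of a decreasing sequence form an initial segment, so their number
  bounds their indices.\<close>

lemma part_length_less_iff:
  assumes "is_partition lam"
  shows "i < part_length lam \<longleftrightarrow> lam i > 0"
proof -
  define k where "k = (LEAST i. lam i = 0)"
  have "\<exists>i. lam i = 0"
    using assms by (auto simp: is_partition_def)
  then have k: "lam k = 0"
    unfolding k_def by (rule LeastI_ex)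
  have pos_iff: "lam i > 0 \<longleftrightarrow> i < k" for i
  proof
    show "i < k" if "lam i > 0"
      using that k assms antimonoD[of lam k i] by (fastforce simp: is_partition_def)
    show "lam i > 0" if "i < k"
      using not_less_Least that by (auto simp: k_def)
  qed
  then have "{i. lam i > 0} = {..<k}"
    by auto
  then show ?thesis
    using pos_iff by (simp add: part_length_def)
qed

definition boxes :: "(nat \<Rightarrow> nat) \<Rightarrow> (nat \<times> int) set" where
  "boxes lam = {(i, j). 1 \<le> j \<and> j \<le> int (lam i)}"

lemma boxes_iff [simp]: "(i, j) \<in> boxes lam \<longleftrightarrow> 1 \<le> j \<and> j \<le> int (lam i)"
  by (simp add: boxes_def)

lemma boxes_altdef:
  "is_partition lam \<Longrightarrow>
    {(i, j). i < part_length lam \<and> 1 \<le> j \<and> j \<le> int (lam i)} = boxes lam"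
  by (auto simp: boxes_def part_length_less_iff)

lemma finite_boxes:
  assumes "is_partition lam"
  shows "finite (boxes lam)"
proof (rule finite_subset)
  show "boxes lam \<subseteq> (SIGMA i:{..<part_length lam}. {1..int (lam i)})"
    using assms by (auto simp: boxes_def part_length_less_iff)
qed auto

definition box_color :: "nat \<Rightarrow> (nat \<Rightarrow> nat) \<Rightarrow> (nat \<Rightarrow> int) \<Rightarrow> nat \<times> int \<Rightarrow> int" where
  "box_color n lam eps = (\<lambda>(i, j). color_of n (eps i + (int (lam i) - j)))"

lemma signature_altdef: "signature n lam eps c = card {p \<in> boxes lam. box_color n lam eps p = c}"
  unfolding signature_def by (rule arg_cong[of _ _ card]) (auto simp: boxes_def box_color_def)

context colored_vector_space
begin

lemma box_color_in [simp]: "box_color n lam eps p \<in> colors n"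
  by (simp add: box_color_def case_prod_beta)

lemma Jordan_basisI:
  assumes "is_partition lam"
    and "inj_on (\<lambda>(i, j). b i j) (boxes lam)" "independent ((\<lambda>(i, j). b i j) ` boxes lam)"
      "span ((\<lambda>(i, j). b i j) ` boxes lam) = UNIV"
    and "\<And>i j. (i, j) \<in> boxes lam \<Longrightarrow> b i j \<in> V (box_color n lam eps (i, j))"
    and "\<And>i j. (i, j) \<in> boxes lam \<Longrightarrow> x (b i j) = b i (j - 1)"
    and "\<And>i j. i < part_length lam \<Longrightarrow> j \<le> 0 \<Longrightarrow> b i j = 0"
  shows "colored_Jordan_basis x lam eps b"
  using assms unfolding colored_Jordan_basis_def Let_def boxes_altdef[OF assms(1)]
  by (auto simp: box_color_def)

lemma Jordan_basisD:
  assumes "colored_Jordan_basis x lam eps b" "is_partition lam"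
  shows "inj_on (\<lambda>(i, j). b i j) (boxes lam)" "independent ((\<lambda>(i, j). b i j) ` boxes lam)"
    "span ((\<lambda>(i, j). b i j) ` boxes lam) = UNIV"
    "\<And>i j. (i, j) \<in> boxes lam \<Longrightarrow> b i j \<in> V (box_color n lam eps (i, j))"
    "\<And>i j. (i, j) \<in> boxes lam \<Longrightarrow> x (b i j) = b i (j - 1)"
    "\<And>i j. i < part_length lam \<Longrightarrow> j \<le> 0 \<Longrightarrow> b i j = 0"
  using assms unfolding colored_Jordan_basis_def Let_def boxes_altdef[OF assms(2)]
  by (auto simp: box_color_def)

text \<open>A basis vector is nonzero and therefore lies in no summand other than that of its color;
  so the members of color \<open>c\<close> are exactly those inside \<open>V c\<close>.\<close>

lemma homogeneous_family_V:
  assumes "inj_on f I" "independent (f ` I)" "span (f ` I) = UNIV"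
    and col: "\<And>p. p \<in> I \<Longrightarrow> col p \<in> colors n \<and> f p \<in> V (col p)" and c: "c \<in> colors n"
  shows "V c = span (f ` {p \<in> I. col p = c})" "dim (V c) = card {p \<in> I. col p = c}"
proof -
  have "f ` I \<inter> V c = f ` {p \<in> I. col p = c}"
  proof (intro equalityI subsetI; clarsimp)
    fix p assume p: "p \<in> I" "f p \<in> V c"
    have "f p \<noteq> 0"
      using assms(2) p(1) dependent_zero by (metis imageI)
    then have "col p = c"
      using V_disjoint[OF p(2)] col[OF p(1)] c by blast
    then show "f p \<in> f ` {p \<in> I. col p = c}"
      using p by auto
  qed (use col in auto)
  moreover have "V c = span (f ` I \<inter> V c)"
    using assms(3) col c by (intro V_eq_span) auto
  ultimately show eq: "V c = span (f ` {p \<in> I. col p = c})"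
    by simp
  have "independent (f ` {p \<in> I. col p = c})"
    using assms(2) by (rule independent_mono) auto
  then have "dim (span (f ` {p \<in> I. col p = c})) = card (f ` {p \<in> I. col p = c})"
    by (rule dim_span_eq_card_independent)
  also have "\<dots> = card {p \<in> I. col p = c}"
    using assms(1) by (intro card_image) (auto simp: inj_on_def)
  finally show "dim (V c) = card {p \<in> I. col p = c}"
    by (simp only: eq)
qed

lemma Jordan_V:
  assumes "colored_Jordan_basis x lam eps b" "is_partition lam" "c \<in> colors n"
  shows "V c = span ((\<lambda>(i, j). b i j) ` {p \<in> boxes lam. box_color n lam eps p = c})"
    "dim (V c) = signature n lam eps c"
  using homogeneous_family_V[OF Jordan_basisD(1-3)[OF assms(1,2)], of "box_color n lam eps" c]
    Jordan_basisD(4)[OF assms(1,2)] assms(3)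
  by (auto simp: signature_altdef)

lemma Jordan_has_signature:
  "colored_Jordan_basis x lam eps b \<Longrightarrow> is_partition lam \<Longrightarrow> has_signature lam eps"
  by (simp add: has_signature_def Jordan_V(2))

end

section \<open>From an adapted family to a Jordan basis of striped type\<close>

context graded_nilpotent
begin

lemma adapted_permute:
  assumes pi: "bij_betw \<pi> {..<N} {..<N}" and ad: "adapted N l e m v nu u"
  shows "adapted N (l \<circ> \<pi>) (e \<circ> \<pi>) m v (nu \<circ> \<pi>) (u \<circ> \<pi>)"
proof -
  have im: "\<pi> ` {..<N} = {..<N}"
    using pi by (simp add: bij_betw_def)
  then have less: "\<pi> i < N" if "i < N" for i
    using that by auto
  have "(u \<circ> \<pi>) ` {..<N} = u ` {..<N}"
    by (metis im image_comp)
  moreover have "(\<Sum>i<N. (x ^^ nu (\<pi> i)) (u (\<pi> i))) = (\<Sum>i<N. (x ^^ nu i) (u i))"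
    by (rule sum.reindex_bij_betw[OF pi])
  ultimately show ?thesis
    using ad less by (auto simp: adapted_def generators_def)
qed

lemma ex_sorting_permutation:
  fixes l :: "nat \<Rightarrow> nat"
  shows "\<exists>\<pi>. bij_betw \<pi> {..<N} {..<N} \<and> (\<forall>i j. i \<le> j \<longrightarrow> j < N \<longrightarrow> l (\<pi> j) \<le> l (\<pi> i))"
proof -
  define js where "js = sort_key (\<lambda>i. - int (l i)) [0..<N]"
  have len: "length js = N" and set: "set js = {..<N}" and dist: "distinct js"
    by (auto simp: js_def)
  have "bij_betw ((!) js) {..<N} {..<N}"
    by (rule bij_betw_nth[OF dist]) (simp_all add: len set)
  moreover have "l (js ! j) \<le> l (js ! i)" if "i \<le> j" "j < N" for i j
  proof -
    have "sorted (map (\<lambda>i. - int (l i)) js)"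
      by (simp add: js_def)
    from sorted_nth_mono[OF this, of i j] show ?thesis
      using that len by simp
  qed
  ultimately show ?thesis
    by blast
qed

lemma sorted_adapted_Jordan_basis:
  assumes ad: "adapted N l e m v nu u" and dim: "(\<Sum>i<N. l i) \<le> dim UNIV" and m: "m \<in> colors n"
    and mono: "\<And>i j. i \<le> j \<Longrightarrow> j < N \<Longrightarrow> l j \<le> l i"
    and small: "\<And>i. i < N \<Longrightarrow> nu i < l i + n"
    and str: "\<And>i j. i < N \<Longrightarrow> j < N \<Longrightarrow> i \<noteq> j \<Longrightarrow> nu i < nu j + n \<or> l j + nu i < l i + nu j + n"
  shows "\<exists>lam eps mu b. (lam, eps, mu) \<in> striped_bipartitions_over m \<and>
    colored_Jordan_basis x lam eps b \<and> v = (\<Sum>i<part_length lam. b i (mu i))"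
proof -
  define lam where "lam i = (if i < N then l i else 0)" for i
  \<comment> \<open>From \<open>N\<close> on the rows are empty. Their colors run periodically
    through all residues, and their mark is the only value above \<open>-n\<close> and at most 0
    that is compatible with \<open>m\<close>.\<close>
  define eps where "eps i = (if i < N then e i else int (i mod n))" for i
  define mu where "mu i = (if i < N then int (l i) - int (nu i) else - ((m - eps i) mod int n))" for i
  define b where "b i j = (if i < N \<and> 0 < j then (x ^^ nat (int (l i) - j)) (u i) else 0)" for i and j :: int
  have genD: "e i \<in> colors n" "u i \<in> V (e i)" "(x ^^ l i) (u i) = 0"
    "color_of n (e i + int (nu i)) = m" if "i < N" for i
    using ad that by (auto simp: adapted_def generators_def)
  have part: "is_partition lam"
    unfolding is_partition_def lam_def using mono by (auto intro!: antimonoI exI[of _ N])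
  have "colored_partition n lam eps"
    unfolding colored_partition_def
  proof (intro conjI part allI ballI)
    show "eps i \<in> colors n" for i
      using genD(1) n_pos by (auto simp: eps_def colors_def)
    fix c assume c: "c \<in> colors n"
    have "\<exists>i\<ge>M. i \<in> {i. eps i = c}" for M
    proof (intro exI conjI)
      have ge: "M + N \<le> (M + N) * n"
        using mult_le_mono2[OF n_pos, of "M + N"] by simp
      then show "M \<le> (M + N) * n + nat c"
        by linarith
      have "\<not> (M + N) * n + nat c < N"
        using ge by linarith
      moreover have "((M + N) * n + nat c) mod n = nat c"
        using c by (auto simp: colors_def nat_less_iff)
      ultimately show "(M + N) * n + nat c \<in> {i. eps i = c}"
        using c unfolding mem_Collect_eq eps_def colors_def by simp
    qed
    then show "infinite {i. eps i = c}"
      unfolding infinite_nat_iff_unbounded_le by blast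
  qed
  moreover have mod_bounds: "0 \<le> k mod int n" "k mod int n < int n" for k
    using n_pos by auto
  have "is_marking lam mu"
    by (auto simp: is_marking_def mu_def lam_def mod_bounds)
  moreover have "mu i > - int n" for i
    using small[of i] mod_bounds by (auto simp: mu_def)
  moreover have "mu j < mu i + int n \<and> comark lam mu j < comark lam mu i + int n" if "i < j" for i j
  proof (cases "j < N")
    case True
    \<comment> \<open>Because \<open>l j \<le> l i\<close>, the first alternative of
      \<open>str\<close> for \<open>(i, j)\<close> implies the second, which is the inequality of
      marks; for \<open>(j, i)\<close> the second implies the first, which is the inequality of
      comarks.\<close>
    then show ?thesis
      using that str[of i j] str[of j i] mono[of i j] by (auto simp: mu_def comark_def lam_def)
  next
    case False
    \<comment> \<open>An empty row satisfies both inequalities against any row above it, because all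
      marks exceed \<open>-n\<close> and no comark is negative.\<close>
    have "mu j \<le> 0" "comark lam mu j < int n"
      using False mod_bounds by (auto simp: mu_def comark_def lam_def)
    moreover have "0 \<le> comark lam mu i" "0 < mu i + int n"
      using mod_bounds small[of i] by (auto simp: mu_def comark_def lam_def)
    ultimately show ?thesis
      by linarith
  qed
  moreover have col_m: "color_of n (eps i + (int (lam i) - mu i)) = m" for i
  proof (cases "i < N")
    case True
    then show ?thesis
      using genD(4) by (simp add: mu_def lam_def eps_def)
  next
    case False
    then have "color_of n (eps i + (int (lam i) - mu i)) = (eps i + (m - eps i)) mod int n"
      by (simp add: mu_def lam_def color_of_def mod_add_right_eq)
    then show ?thesis
      using m by (simp add: colors_def)
  qed
  ultimately have striped: "striped_bipartition n lam eps mu"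
    by (simp add: striped_bipartition_def comark_def)
  let ?f = "\<lambda>(i, j). b i j"
  have bij: "bij_betw (\<lambda>(i, a). (i, int (l i) - int a)) (power_boxes N l) (boxes lam)"
    by (rule bij_betw_byWitness[where f' = "\<lambda>(i, j). (i, nat (int (l i) - j))"])
      (auto simp: power_boxes_def lam_def split: if_splits)
  have "?f ` boxes lam = (\<lambda>(i, a). (x ^^ a) (u i)) ` power_boxes N l"
    unfolding bij_betw_imp_surj_on[OF bij, symmetric] image_image
    by (rule image_cong) (auto simp: power_boxes_def b_def)
  moreover have "generators N l e u"
    using ad by (simp add: adapted_def)
  ultimately have span: "span (?f ` boxes lam) = UNIV"
    using generators_span by simp
  have card: "card (boxes lam) \<le> dim UNIV"
    using bij_betw_same_card[OF bij] dim by (simp add: card_power_boxes)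
  have jb: "colored_Jordan_basis x lam eps b"
  proof (rule Jordan_basisI[OF part])
    show "inj_on ?f (boxes lam)" "independent (?f ` boxes lam)"
      using spanning_family_independent[OF finite_boxes[OF part] span card] by auto
    fix i j assume ij: "(i, j) \<in> boxes lam"
    then have i: "i < N" "1 \<le> j" "j \<le> int (l i)"
      by (auto simp: lam_def split: if_splits)
    have "(x ^^ nat (int (l i) - j)) (u i) \<in> V (color_of n (e i + int (nat (int (l i) - j))))"
      using genD i by (intro xk_V) auto
    then show "b i j \<in> V (box_color n lam eps (i, j))"
      using i by (simp add: b_def box_color_def eps_def lam_def)
    show "x (b i j) = b i (j - 1)"
    proof (cases "j = 1")
      case True
      then have "x (b i j) = (x ^^ Suc (nat (int (l i) - j))) (u i)"
        using i by (simp add: b_def)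
      also have "Suc (nat (int (l i) - j)) = l i"
        using True i by auto
      finally show ?thesis
        using genD(3) i True by (simp add: b_def)
    next
      case False
      then have "nat (int (l i) - (j - 1)) = Suc (nat (int (l i) - j))"
        using i by auto
      then show ?thesis
        using False i by (simp add: b_def)
    qed
  qed (use span in \<open>auto simp: b_def\<close>)
  have "b i (mu i) = (x ^^ nu i) (u i)" if "i < N" for i
  proof (cases "nu i < l i")
    case True
    then show ?thesis
      using that by (simp add: b_def mu_def)
  next
    case False
    then show ?thesis
      using that genD(3)[OF that] xk_zero_ge[of "l i" "u i" "nu i"] by (simp add: b_def mu_def)
  qed
  then have "v = (\<Sum>i<N. b i (mu i))"
    using ad by (simp add: adapted_def)
  \<comment> \<open>Some of the \<open>N\<close> generators may have length 0; such rows have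
    nonpositive marks and contribute 0.\<close>
  also have "\<dots> = (\<Sum>i<part_length lam. b i (mu i))"
  proof (rule sum.mono_neutral_right)
    show "{..<part_length lam} \<subseteq> {..<N}"
    proof (rule subsetI)
      fix i assume "i \<in> {..<part_length lam}"
      then have "0 < lam i"
        using part_length_less_iff[OF part, of i] by simp
      then show "i \<in> {..<N}"
        by (cases "i < N") (simp_all add: lam_def)
    qed
    show "\<forall>i\<in>{..<N} - {..<part_length lam}. b i (mu i) = 0"
    proof
      fix i assume "i \<in> {..<N} - {..<part_length lam}"
      then have "i < N" "lam i = 0"
        using part_length_less_iff[OF part, of i] by auto
      then show "b i (mu i) = 0"
        by (simp add: lam_def b_def mu_def)
    qed
  qed simp
  finally show ?thesis
    using striped col_m jb Jordan_has_signature[OF jb part]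
    by (auto simp: striped_bipartitions_over_def)
qed

lemma ex_striped_Jordan_basis:
  assumes "v \<in> V m" "m \<in> colors n"
  shows "\<exists>lam eps mu b. (lam, eps, mu) \<in> striped_bipartitions_over m \<and>
    colored_Jordan_basis x lam eps b \<and> v = (\<Sum>i<part_length lam. b i (mu i))"
proof -
  obtain N l e u where gen: "generators N l e u" and dim: "(\<Sum>i<N. l i) \<le> dim UNIV"
    using ex_generators_basis by blast
  obtain nu0 u0 where "adapted N l e m v nu0 u0"
    using ex_adapted[OF gen assms] by blast
  then obtain nu u' where ad: "adapted N l e m v nu u'" and small: "\<forall>i<N. nu i < l i + n"
    and str: "\<forall>i<N. \<forall>j<N. i \<noteq> j \<longrightarrow> nu i < nu j + n \<or> l j + nu i < l i + nu j + n"
    using ex_adapted_striped by blast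
  obtain \<pi> where pi: "bij_betw \<pi> {..<N} {..<N}"
    and mono: "\<And>i j. i \<le> j \<Longrightarrow> j < N \<Longrightarrow> l (\<pi> j) \<le> l (\<pi> i)"
    using ex_sorting_permutation by blast
  have less: "\<pi> i < N" if "i < N" for i
    using pi that by (auto simp: bij_betw_def)
  have inj: "\<pi> i \<noteq> \<pi> j" if "i < N" "j < N" "i \<noteq> j" for i j
    using pi that by (auto simp: bij_betw_def inj_on_def)
  have "(\<Sum>i<N. l (\<pi> i)) \<le> dim UNIV"
    using dim sum.reindex_bij_betw[OF pi, of l] by simp
  then show ?thesis
    using small str less inj mono assms
    by (intro sorted_adapted_Jordan_basis[OF adapted_permute[OF pi ad]]) auto
qed

end

section \<open>Orbits and the map \<open>\<Psi>\<close>\<close>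

lemma equiv_row_equiv: "equiv UNIV row_equiv"
proof (rule equivI)
  show "refl row_equiv"
    by (rule reflI) (force simp: row_equiv_def intro: exI[of _ id])
  show "sym row_equiv"
  proof (rule symI)
    fix P Q assume "(P, Q) \<in> row_equiv"
    then obtain lam eps mu p where p: "bij p" "\<And>i. lam (p i) = lam i"
      and PQ: "P = (lam, eps, mu)" "Q = (lam \<circ> p, eps \<circ> p, mu \<circ> p)"
      unfolding row_equiv_def by auto
    have pi: "p (inv p i) = i" for i
      using bij_is_surj[OF p(1)] by (rule surj_f_inv_f)
    then have "lam (inv p i) = lam i" for i
      using p(2)[of "inv p i"] by simp
    then show "(Q, P) \<in> row_equiv"
      unfolding row_equiv_def PQ using p pi
      by (auto intro!: exI[of _ "inv p"] simp: bij_imp_bij_inv fun_eq_iff)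
  qed
  show "trans row_equiv"
  proof (rule transI)
    fix P Q R assume PQ: "(P, Q) \<in> row_equiv" and QR: "(Q, R) \<in> row_equiv"
    obtain lam eps mu p where p: "bij p" "\<And>i. lam (p i) = lam i"
      and P: "P = (lam, eps, mu)" and Q: "Q = (lam \<circ> p, eps \<circ> p, mu \<circ> p)"
      using PQ unfolding row_equiv_def by auto
    obtain q where q: "bij q" "\<And>i. lam (p (q i)) = lam (p i)"
      and R: "R = (lam \<circ> p \<circ> q, eps \<circ> p \<circ> q, mu \<circ> p \<circ> q)"
      using QR unfolding row_equiv_def Q by auto
    show "(P, R) \<in> row_equiv"
      unfolding row_equiv_def P R using p q by (auto intro!: exI[of _ "p \<circ> q"] simp: bij_comp)
  qed
qed simp

section \<open>The group action, conjugation of Jordan bases, and well-definedness of the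
  orbit\<close>

context colored_vector_space
begin

interpretation lp: vector_space_pair scale scale
  by unfold_locales

lemma K_lin: "k \<in> K \<Longrightarrow> lin k"
  by (simp add: K_def)

lemma K_image_V: "k \<in> K \<Longrightarrow> c \<in> colors n \<Longrightarrow> k ` V c = V c"
  by (simp add: K_def bij_betw_def)

lemma K_V: "k \<in> K \<Longrightarrow> c \<in> colors n \<Longrightarrow> v \<in> V c \<Longrightarrow> k v \<in> V c"
  using K_image_V by blast

text \<open>\<open>act\<close> uses an inverse on the whole space, while \<open>K\<close> asks for
  bijections on the summands. The components of a kernel vector are mapped into their own summands,
  so each is killed separately; and the image contains every summand.\<close>

lemma K_bij:
  assumes "k \<in> K"
  shows "bij k"
proof -
  have "inj k"
  proof (subst lp.linear_inj_iff_eq_0[OF K_lin[OF assms]], intro allI impI)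
    fix v assume kv: "k v = 0"
    obtain f where f: "f \<in> (\<Pi>\<^sub>E c\<in>colors n. V c)" "v = (\<Sum>c\<in>colors n. f c)"
      using direct_sum[of v] by blast
    have fV: "f c \<in> V c" if "c \<in> colors n" for c
      using f(1) that by (rule PiE_mem)
    have "(\<Sum>c\<in>colors n. k (f c)) = 0"
      using kv unfolding f(2) lin_sum[OF K_lin[OF assms]] .
    then have "k (f c) = 0" if "c \<in> colors n" for c
      using component_zero[of "\<lambda>c. k (f c)" c] K_V[OF assms _ fV] that by blast
    moreover have "w = 0" if "k w = 0" "w \<in> V c" "c \<in> colors n" for w c
      using assms that subspace_0[OF subspace_V[OF that(3)]] lin_0[OF K_lin[OF assms]]
      by (auto simp: K_def bij_betw_def inj_on_def)
    ultimately have "f c = 0" if "c \<in> colors n" for c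
      using that fV by blast
    then show "v = 0"
      by (simp add: f(2))
  qed
  moreover have "(\<Union>c\<in>colors n. V c) \<subseteq> range k"
    using K_image_V[OF assms] by blast
  then have "span (\<Union>c\<in>colors n. V c) \<subseteq> range k"
    by (rule span_minimal) (intro lp.linear_subspace_image K_lin assms subspace_UNIV)
  then have "surj k"
    unfolding UNIV_eq_span_V by blast
  ultimately show ?thesis
    by (simp add: bij_def)
qed

lemma K_inv:
  assumes "k \<in> K"
  shows "inv k \<in> K"
proof -
  have "lin (inv k)"
    using bij_module_hom_imp_inv_module_hom[of scale scale k] K_lin[OF assms] K_bij[OF assms]
    by (simp add: module_hom_iff_linear)
  moreover have "bij_betw (inv k) (V c) (V c)" if "c \<in> colors n" for c
  proof -
    have "inv k ` V c = V c"
      using image_inv_f_f[OF bij_is_inj[OF K_bij[OF assms]], of "V c"] K_image_V[OF assms that]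
      by simp
    moreover have "inj (inv k)"
      using K_bij[OF assms] by (simp add: bij_imp_bij_inv bij_is_inj)
    ultimately show ?thesis
      by (auto simp: bij_betw_def intro: inj_on_subset)
  qed
  ultimately show ?thesis
    by (simp add: K_def)
qed

lemma K_comp: "j \<in> K \<Longrightarrow> k \<in> K \<Longrightarrow> j \<circ> k \<in> K"
  by (auto simp: K_def intro: lin_comp bij_betw_trans)

lemma act_act:
  assumes "j \<in> K" "k \<in> K"
  shows "act j (act k a) = act (j \<circ> k) a"
  using o_inv_distrib[OF K_bij K_bij, OF assms] by (cases a) (simp add: act_def comp_assoc)

lemma K_orbit_act:
  assumes k: "k \<in> K"
  shows "K_orbit (act k a) = K_orbit a"
proof
  show "K_orbit (act k a) \<subseteq> K_orbit a"
    using act_act[OF _ k] K_comp[OF _ k] by (auto simp: K_orbit_def)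
  show "K_orbit a \<subseteq> K_orbit (act k a)"
    unfolding K_orbit_def
  proof (rule image_subsetI)
    fix j assume j: "j \<in> K"
    have "j \<circ> inv k \<circ> k = j"
      using K_bij[OF k] by (simp add: comp_assoc bij_is_inj)
    then have "act j a = act (j \<circ> inv k) (act k a)"
      using act_act[OF K_comp[OF j K_inv[OF k]] k] by simp
    then show "act j a \<in> (\<lambda>j. act j (act k a)) ` K"
      using K_comp[OF j K_inv[OF k]] by blast
  qed
qed

lemma K_orbit_self: "a \<in> K_orbit a"
proof -
  have "id \<in> K"
    using lin_id by (auto simp: K_def id_def bij_betw_def)
  moreover have "act id a = a"
    by (cases a) (simp add: act_def)
  ultimately show ?thesis
    unfolding K_orbit_def by force
qed

lemma Jordan_basis_transport:
  assumes k: "k \<in> K" and jb: "colored_Jordan_basis x lam eps b" and part: "is_partition lam"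
  shows "colored_Jordan_basis (k \<circ> x \<circ> inv k) lam eps (\<lambda>i j. k (b i j))"
proof (rule Jordan_basisI[OF part])
  note D = Jordan_basisD[OF jb part]
  have inj: "inj k"
    using K_bij[OF k] by (rule bij_is_inj)
  have f: "(\<lambda>(i, j). k (b i j)) = k \<circ> (\<lambda>(i, j). b i j)"
    by auto
  show "inj_on (\<lambda>(i, j). k (b i j)) (boxes lam)"
    unfolding f using D(1) inj by (auto intro: comp_inj_on inj_on_subset)
  show "independent ((\<lambda>(i, j). k (b i j)) ` boxes lam)"
    unfolding f image_comp[symmetric] using inj
    by (intro lp.linear_independent_injective_image[OF K_lin[OF k] D(2)]) (auto intro: inj_on_subset)
  show "span ((\<lambda>(i, j). k (b i j)) ` boxes lam) = UNIV"
    unfolding f image_comp[symmetric] lin_span_image[OF K_lin[OF k]] D(3)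
    using K_bij[OF k] by (rule bij_is_surj)
  show "k (b i j) \<in> V (box_color n lam eps (i, j))" if "(i, j) \<in> boxes lam" for i j
    using D(4)[OF that] by (intro K_V[OF k]) auto
  show "(k \<circ> x \<circ> inv k) (k (b i j)) = k (b i (j - 1))" if "(i, j) \<in> boxes lam" for i j
    using D(5)[OF that] inj by simp
  show "k (b i j) = 0" if "i < part_length lam" "j \<le> 0" for i j
    using D(6)[OF that] lin_0[OF K_lin[OF k]] by simp
qed

lemma lin_comp_eq_id:
  assumes "lin f" "lin g" "span B = UNIV" "\<And>w. w \<in> B \<Longrightarrow> f (g w) = w"
  shows "f \<circ> g = id"
proof
  fix v
  have "v \<in> span B"
    by (simp add: assms(3))
  from lin_eq_on_span[OF lin_comp[OF assms(1,2)] lin_id _ this] show "(f \<circ> g) v = id v"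
    using assms(4) by simp
qed

text \<open>The linear map matching the two bases box by box preserves \<open>V c\<close>, which is
  spanned by the boxes of color \<open>c\<close> in either basis. Indices \<open>j \<le> 0\<close>
  are included so that nonpositive marks are covered as well.\<close>

lemma Jordan_basis_conjugate:
  assumes jb: "colored_Jordan_basis x lam eps b" and jb': "colored_Jordan_basis x' lam eps b'"
    and part: "is_partition lam" and lin: "lin x" "lin x'"
  shows "\<exists>k\<in>K. (\<forall>i<part_length lam. \<forall>j\<le>int (lam i). k (b i j) = b' i j) \<and> k \<circ> x \<circ> inv k = x'"
proof -
  note D = Jordan_basisD[OF jb part] and D' = Jordan_basisD[OF jb' part]
  let ?f = "\<lambda>(i, j). b i j" and ?f' = "\<lambda>(i, j). b' i j"
  obtain k where k: "lin k" "\<forall>p\<in>boxes lam. k (?f p) = ?f' p"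
    using family_lin_extend[OF D(1,2)] by blast
  obtain g where g: "lin g" "\<forall>p\<in>boxes lam. g (?f' p) = ?f p"
    using family_lin_extend[OF D'(1,2)] by blast
  have "g \<circ> k = id"
  proof (rule lin_comp_eq_id[OF g(1) k(1) D(3)])
    fix w assume "w \<in> ?f ` boxes lam"
    then obtain p where "p \<in> boxes lam" "w = ?f p"
      by (rule imageE)
    then show "g (k w) = w"
      using k(2) g(2) by simp
  qed
  moreover have "k \<circ> g = id"
  proof (rule lin_comp_eq_id[OF k(1) g(1) D'(3)])
    fix w assume "w \<in> ?f' ` boxes lam"
    then obtain p where "p \<in> boxes lam" "w = ?f' p"
      by (rule imageE)
    then show "k (g w) = w"
      using k(2) g(2) by simp
  qed
  ultimately have bij: "bij k"
    by (rule o_bij)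
  have "k ` V c = V c" if c: "c \<in> colors n" for c
  proof -
    let ?S = "{p \<in> boxes lam. box_color n lam eps p = c}"
    have "k ` span (?f ` ?S) = span ((k \<circ> ?f) ` ?S)"
      by (simp add: image_comp flip: lin_span_image[OF k(1)])
    also have "(k \<circ> ?f) ` ?S = ?f' ` ?S"
      using k(2) by (intro image_cong) auto
    finally show ?thesis
      using Jordan_V(1)[OF jb part c] Jordan_V(1)[OF jb' part c] by simp
  qed
  then have "k \<in> K"
    using k(1) bij by (auto simp: K_def bij_betw_def bij_def intro: inj_on_subset)
  moreover have kb: "k (b i j) = b' i j" if "i < part_length lam" "j \<le> int (lam i)" for i j
  proof (cases "j \<le> 0")
    case True
    then show ?thesis
      using D(6) D'(6) that lin_0[OF k(1)] by simp
  next
    case False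
    then have "(i, j) \<in> boxes lam"
      using that by simp
    from bspec[OF k(2) this] show ?thesis
      by simp
  qed
  moreover have "k \<circ> x \<circ> inv k = x'"
  proof -
    have "(k \<circ> x) v = (x' \<circ> k) v" for v
    proof (rule lin_eq_on_span[OF lin_comp[OF k(1) lin(1)] lin_comp[OF lin(2) k(1)]])
      show "v \<in> span (?f ` boxes lam)"
        by (simp add: D(3))
      fix w assume "w \<in> ?f ` boxes lam"
      then obtain i j where ij: "(i, j) \<in> boxes lam" "w = b i j"
        by auto
      then have "i < part_length lam"
        by (auto simp: part_length_less_iff[OF part])
      then show "(k \<circ> x) w = (x' \<circ> k) w"
        using ij D(5)[OF ij(1)] D'(5)[OF ij(1)] kb[of i] by simp
    qed
    then have "k \<circ> x = x' \<circ> k"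
      by auto
    moreover have "k \<circ> inv k = id"
      using bij_is_surj[OF bij] by (simp add: surj_iff)
    ultimately show ?thesis
      by (simp add: comp_assoc)
  qed
  ultimately show ?thesis
    by blast
qed

text \<open>Equality of signatures allows a homogeneous basis of the space to be labelled by the
  boxes, color by color; \<open>x\<close> is then the shift along the rows. This shows that the
  description of the orbit in \<open>Psi\<close> is satisfiable.\<close>

lemma ex_Jordan_basis:
  assumes part: "is_partition lam" and sig: "has_signature lam eps"
  shows "\<exists>x b. x \<in> nilcone \<and> colored_Jordan_basis x lam eps b"
proof -
  obtain B where B: "B \<subseteq> (\<Union>c\<in>colors n. V c)" "independent B" "(\<Union>c\<in>colors n. V c) \<subseteq> span B"
    using maximal_independent_subset .
  have spB: "span B = UNIV"
    using span_minimal[OF B(3)] UNIV_eq_span_V by auto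
  let ?col = "box_color n lam eps"
  have "\<exists>h. bij_betw h {p \<in> boxes lam. ?col p = c} (B \<inter> V c)" if c: "c \<in> colors n" for c
  proof (rule finite_same_card_bij)
    show "finite {p \<in> boxes lam. ?col p = c}"
      using finite_boxes[OF part] by simp
    show "finite (B \<inter> V c)"
      using finite_independent[OF B(2)] by simp
    have "card (B \<inter> V c) = dim (V c)"
      using dim_span_eq_card_independent[OF independent_mono[OF B(2)], of "B \<inter> V c"]
        V_eq_span[OF spB B(1) c] by simp
    then show "card {p \<in> boxes lam. ?col p = c} = card (B \<inter> V c)"
      using sig c by (simp add: has_signature_def signature_altdef)
  qed
  then obtain h where h: "\<And>c. c \<in> colors n \<Longrightarrow> bij_betw (h c) {p \<in> boxes lam. ?col p = c} (B \<inter> V c)"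
    by metis
  define f where "f p = h (?col p) p" for p
  have f_in: "f p \<in> B \<inter> V (?col p)" if "p \<in> boxes lam" for p
    using bij_betw_apply[OF h[of "?col p"], of p] that by (simp add: f_def)
  have "inj_on f (boxes lam)"
  proof (rule inj_onI)
    fix p q assume pq: "p \<in> boxes lam" "q \<in> boxes lam" "f p = f q"
    have "f p \<noteq> 0"
      using f_in[OF pq(1)] B(2) dependent_zero by (metis IntD1)
    then have "?col p = ?col q"
      using V_disjoint[of "f p" "?col p" "?col q"] f_in[OF pq(1)] f_in[OF pq(2)] pq(3) by auto
    then have "h (?col p) p = h (?col p) q" "p \<in> {r \<in> boxes lam. ?col r = ?col p}"
      "q \<in> {r \<in> boxes lam. ?col r = ?col p}"
      using pq by (simp_all add: f_def)
    then show "p = q"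
      using bij_betw_imp_inj_on[OF h[of "?col p"]] by (simp add: inj_onD)
  qed
  have "f ` boxes lam = B"
  proof
    show "B \<subseteq> f ` boxes lam"
    proof
      fix v assume "v \<in> B"
      then obtain c where c: "c \<in> colors n" "v \<in> B \<inter> V c"
        using B(1) by blast
      then have "v \<in> h c ` {p \<in> boxes lam. ?col p = c}"
        using bij_betw_imp_surj_on[OF h[OF c(1)]] by simp
      then obtain p where "p \<in> {p \<in> boxes lam. ?col p = c}" "v = h c p"
        by (elim imageE)
      then show "v \<in> f ` boxes lam"
        by (intro image_eqI[of _ _ p]) (simp_all add: f_def)
    qed
  qed (use f_in in auto)
  define b where "b i j = (if (i, j) \<in> boxes lam then f (i, j) else 0)" for i j
  have bf: "(\<lambda>(i, j). b i j) p = f p" if "p \<in> boxes lam" for p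
    using that by (cases p) (simp add: b_def)
  have im: "(\<lambda>(i, j). b i j) ` boxes lam = B"
    using \<open>f ` boxes lam = B\<close> bf by (simp cong: image_cong)
  have inj: "inj_on (\<lambda>(i, j). b i j) (boxes lam)"
    using \<open>inj_on f (boxes lam)\<close> bf by (simp cong: inj_on_cong)
  have bV: "b i j \<in> V (?col (i, j))" for i j
    using f_in[of "(i, j)"] subspace_0[OF subspace_V] by (auto simp: b_def)
  obtain x where x: "lin x" "\<forall>p\<in>boxes lam. x ((\<lambda>(i, j). b i j) p) = (\<lambda>(i, j). b i (j - 1)) p"
    using family_lin_extend[OF inj, of "\<lambda>(i, j). b i (j - 1)"] im B(2) by auto
  have xb: "x (b i j) = b i (j - 1)" if "j \<le> int (lam i)" for i j
  proof (cases "(i, j) \<in> boxes lam")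
    case False
    then show ?thesis
      using that lin_0[OF x(1)] by (auto simp: b_def)
  next
    case True
    from bspec[OF x(2) this] show ?thesis
      by simp
  qed
  have "colored_Jordan_basis x lam eps b"
  proof (rule Jordan_basisI[OF part inj])
    show "independent ((\<lambda>(i, j). b i j) ` boxes lam)" "span ((\<lambda>(i, j). b i j) ` boxes lam) = UNIV"
      unfolding im by (fact B(2) spB)+
    show "b i j \<in> V (?col (i, j))" for i j
      by (rule bV)
    show "x (b i j) = b i (j - 1)" if "(i, j) \<in> boxes lam" for i j
      using that by (intro xb) simp
    show "b i j = 0" if "j \<le> 0" for i j
      using that by (simp add: b_def)
  qed
  moreover have "x \<in> nilcone"
  proof -
    have xk: "(x ^^ k) (b i j) = b i (j - int k)" if "j \<le> int (lam i)" for i j k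
      using that by (induction k) (auto simp: xb algebra_simps)
    \<comment> \<open>Row 0 is the longest, so a shift by its length leaves no box.\<close>
    have "(x ^^ lam 0) v = 0" for v
    proof (rule lp.linear_eq_0_on_span[OF lin_funpow[OF x(1)]])
      show "v \<in> span B"
        by (simp add: spB)
      fix w assume "w \<in> B"
      then obtain i j where ij: "(i, j) \<in> boxes lam" "w = b i j"
        using im by auto
      then have "j \<le> int (lam i)" "int (lam i) \<le> int (lam 0)"
        using part by (auto simp: is_partition_def antimono_def)
      then show "(x ^^ lam 0) w = 0"
        using xk[of j i "lam 0"] ij by (simp add: b_def)
    qed
    moreover have "x ` V c \<subseteq> V (color_of n (c + 1))" if c: "c \<in> colors n" for c
    proof -
      let ?S = "{p \<in> boxes lam. ?col p = c}"
      have "V c = span ((\<lambda>(i, j). b i j) ` ?S)"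
        using inj im B(2) spB bV c by (intro homogeneous_family_V(1)[of _ "boxes lam"]) auto
      then have "x ` V c = span (x ` (\<lambda>(i, j). b i j) ` ?S)"
        by (simp add: lin_span_image[OF x(1)])
      also have "\<dots> \<subseteq> V (color_of n (c + 1))"
      proof (rule span_minimal)
        show "x ` (\<lambda>(i, j). b i j) ` ?S \<subseteq> V (color_of n (c + 1))"
        proof clarify
          fix i j assume ij: "(i, j) \<in> boxes lam" "c = ?col (i, j)"
          have "color_of n (?col (i, j) + 1) = color_of n (eps i + (int (lam i) - j) + 1)"
            by (simp only: box_color_def prod.case color_of_add_left)
          also have "\<dots> = ?col (i, j - 1)"
            by (simp add: box_color_def algebra_simps)
          finally show "x (b i j) \<in> V (color_of n (?col (i, j) + 1))"
            using xb[of j i] bV[of i "j - 1"] ij by simp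
        qed
      qed (simp add: subspace_V)
      finally show ?thesis .
    qed
    ultimately show ?thesis
      using x(1) by (auto simp: nilcone_def)
  qed
  ultimately show ?thesis
    by blast
qed

text \<open>Two choices of endomorphism and basis are related by an element of \<open>K\<close>. As
  a marking never exceeds the row lengths, this element also carries one marked vector to the other,
  so only one orbit fits.\<close>

lemma Psi_eq:
  assumes x: "x \<in> nilcone" and jb: "colored_Jordan_basis x lam eps b"
    and part: "is_partition lam" and mark: "is_marking lam mu"
  shows "Psi (lam, eps, mu) = K_orbit (\<Sum>i<part_length lam. b i (mu i), x)"
  unfolding Psi_def prod.case
proof (rule the_equality)
  show "\<exists>x' b'. x' \<in> nilcone \<and> colored_Jordan_basis x' lam eps b' \<and>
      K_orbit (\<Sum>i<part_length lam. b i (mu i), x) = K_orbit (\<Sum>i<part_length lam. b' i (mu i), x')"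
    using x jb by blast
  fix Orb assume "\<exists>x' b'. x' \<in> nilcone \<and> colored_Jordan_basis x' lam eps b' \<and>
      Orb = K_orbit (\<Sum>i<part_length lam. b' i (mu i), x')"
  then obtain x' b' where x': "x' \<in> nilcone" and jb': "colored_Jordan_basis x' lam eps b'"
    and Orb: "Orb = K_orbit (\<Sum>i<part_length lam. b' i (mu i), x')"
    by blast
  have "lin x" "lin x'"
    using x x' by (simp_all add: nilcone_def)
  then obtain k where k: "k \<in> K" "\<forall>i<part_length lam. \<forall>j\<le>int (lam i). k (b i j) = b' i j"
    "k \<circ> x \<circ> inv k = x'"
    using Jordan_basis_conjugate[OF jb jb' part] by blast
  have "k (\<Sum>i<part_length lam. b i (mu i)) = (\<Sum>i<part_length lam. b' i (mu i))"
    unfolding lin_sum[OF K_lin[OF k(1)]] using k(2) mark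
    by (intro sum.cong) (auto simp: is_marking_def)
  then have "act k (\<Sum>i<part_length lam. b i (mu i), x) = (\<Sum>i<part_length lam. b' i (mu i), x')"
    using k(3) by (simp add: act_def)
  then show "Orb = K_orbit (\<Sum>i<part_length lam. b i (mu i), x)"
    using K_orbit_act[OF k(1)] Orb by metis
qed

lemma striped_overD:
  assumes "(lam, eps, mu) \<in> striped_bipartitions_over m"
  shows "is_partition lam" "is_marking lam mu" "has_signature lam eps"
    "\<And>i. - int n < mu i" "\<And>i j. i < j \<Longrightarrow> mu j < mu i + int n"
    "\<And>i j. i < j \<Longrightarrow> int (lam j) - mu j < int (lam i) - mu i + int n"
    "\<And>i. color_of n (eps i + (int (lam i) - mu i)) = m"
    "\<And>i. eps i \<in> colors n" "\<And>c. c \<in> colors n \<Longrightarrow> infinite {i. eps i = c}"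
  using assms
  by (auto simp: striped_bipartitions_over_def striped_bipartition_def colored_partition_def comark_def)

text \<open>One endomorphism serves both types: with its rows permuted, the basis has the permuted
  colors, and the summands of the vector are merely reordered. Preservation of lengths keeps the
  nonempty rows among themselves.\<close>

lemma Psi_row_equiv:
  assumes P: "P \<in> striped_bipartitions_over m" and PQ: "(P, Q) \<in> row_equiv"
  shows "Psi Q = Psi P"
proof -
  obtain lam eps mu where P_eq: "P = (lam, eps, mu)"
    by (cases P)
  obtain p where p: "bij p" "\<And>i. lam (p i) = lam i" and "Q = (lam \<circ> p, eps \<circ> p, mu \<circ> p)"
    using PQ unfolding row_equiv_def P_eq by auto
  moreover have "lam \<circ> p = lam"
    using p(2) by auto
  ultimately have Q_eq: "Q = (lam, eps \<circ> p, mu \<circ> p)"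
    by simp
  note D = striped_overD[OF P[unfolded P_eq]]
  obtain x b where x: "x \<in> nilcone" and jb: "colored_Jordan_basis x lam eps b"
    using ex_Jordan_basis[OF D(1,3)] by blast
  note J = Jordan_basisD[OF jb D(1)]
  have bij: "bij_betw (\<lambda>(i, j). (p i, j)) (boxes lam) (boxes lam)"
    using p bij_is_inj[OF p(1)] bij_is_surj[OF p(1)]
    by (intro bij_betw_byWitness[where f' = "\<lambda>(i, j). (inv p i, j)"])
      (auto simp: surj_f_inv_f, metis p(2) surj_f_inv_f bij_is_surj[OF p(1)])
  have comp: "(\<lambda>(i, j). b (p i) j) = (\<lambda>(i, j). b i j) \<circ> (\<lambda>(i, j). (p i, j))"
    by auto
  have jb': "colored_Jordan_basis x lam (eps \<circ> p) (\<lambda>i j. b (p i) j)"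
  proof (rule Jordan_basisI[OF D(1)])
    show "inj_on (\<lambda>(i, j). b (p i) j) (boxes lam)"
      unfolding comp using J(1) bij by (intro comp_inj_on) (auto simp: bij_betw_def)
    have im: "(\<lambda>(i, j). b (p i) j) ` boxes lam = (\<lambda>(i, j). b i j) ` boxes lam"
      unfolding comp image_comp[symmetric] using bij by (simp add: bij_betw_def)
    show "independent ((\<lambda>(i, j). b (p i) j) ` boxes lam)"
      "span ((\<lambda>(i, j). b (p i) j) ` boxes lam) = UNIV"
      unfolding im by (fact J(2,3))+
    show "b (p i) j \<in> V (box_color n lam (eps \<circ> p) (i, j))" if "(i, j) \<in> boxes lam" for i j
      using J(4)[of "p i" j] that by (simp add: box_color_def p(2))
    show "x (b (p i) j) = b (p i) (j - 1)" if "(i, j) \<in> boxes lam" for i j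
      using J(5)[of "p i" j] that by (simp add: p(2))
    show "b (p i) j = 0" if "i < part_length lam" "j \<le> 0" for i j
      using J(6)[of "p i" j] that by (simp add: p(2) part_length_less_iff[OF D(1)])
  qed
  have "bij_betw p {..<part_length lam} {..<part_length lam}"
  proof (rule bij_betw_imageI)
    show "inj_on p {..<part_length lam}"
      using bij_is_inj[OF p(1)] by (rule inj_on_subset) simp
    show "p ` {..<part_length lam} = {..<part_length lam}"
    proof (intro equalityI subsetI)
      fix i assume "i \<in> {..<part_length lam}"
      moreover obtain i' where "i = p i'"
        using bij_is_surj[OF p(1)] by blast
      ultimately show "i \<in> p ` {..<part_length lam}"
        by (simp add: p(2) part_length_less_iff[OF D(1)])
    qed (auto simp: p(2) part_length_less_iff[OF D(1)])
  qed
  then have "(\<Sum>i<part_length lam. b (p i) ((mu \<circ> p) i)) = (\<Sum>i<part_length lam. b i (mu i))"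
    using sum.reindex_bij_betw[of p _ _ "\<lambda>i. b i (mu i)"] by simp
  moreover have "is_marking lam (mu \<circ> p)"
    using D(2) p(2) unfolding is_marking_def by (metis comp_apply)
  ultimately show ?thesis
    using Psi_eq[OF x jb D(1,2)] Psi_eq[OF x jb' D(1)] by (simp add: P_eq Q_eq)
qed

end

section \<open>Recovering the marks from the orbit\<close>

text \<open>Deleting \<open>q\<close> boxes from each row leaves a partition whose length is this
  cardinality. Hence a partition is determined by its column lengths.\<close>

lemma less_partition_iff:
  assumes "is_partition lam"
  shows "q < lam i \<longleftrightarrow> i < card {k. q < lam k}"
proof -
  obtain N where "\<forall>i\<ge>N. lam i = 0"
    using assms by (auto simp: is_partition_def)
  then have "\<forall>i\<ge>N. lam i - q = 0"
    by simp
  moreover have "antimono (\<lambda>i. lam i - q)"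
    using assms by (auto simp: is_partition_def antimono_def intro: diff_le_mono)
  ultimately have "is_partition (\<lambda>i. lam i - q)"
    unfolding is_partition_def by blast
  from part_length_less_iff[OF this, of i] show ?thesis
    by (simp add: part_length_def)
qed

text \<open>The difference is a multiple of \<open>n\<close> smaller than \<open>n\<close>. This
  turns the striped inequalities, which have slack \<open>n\<close>, into plain ones between
  congruent heights.\<close>

lemma cong_lower_bound:
  fixes a b n :: int
  assumes "a mod n = b mod n" "a < b + n"
  shows "a \<le> b"
proof (rule ccontr)
  assume "\<not> a \<le> b"
  moreover have "n dvd a - b"
    using assms(1) by (simp add: mod_eq_dvd_iff)
  ultimately show False
    using assms(2) zdvd_imp_le[of n "a - b"] by simp
qed

lemma (in colored_vector_space) color_of_eq_iff:
  "color_of n a = color_of n b \<longleftrightarrow> int n dvd a - b"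
  by (simp add: color_of_def mod_eq_dvd_iff)

lemma (in colored_vector_space) family_coeff_zero:
  assumes "finite I" "inj_on f I" "independent (f ` I)" "(\<Sum>i\<in>I. scale (r i) (f i)) = 0" "i \<in> I"
  shows "r i = 0"
proof -
  have "(\<Sum>v\<in>f ` I. scale ((r \<circ> inv_into I f) v) v) = 0"
    using assms(4) by (simp add: sum.reindex[OF assms(2)] assms(2))
  then have "(r \<circ> inv_into I f) (f i) = 0"
    using independentD[OF assms(3) finite_imageI[OF assms(1)] subset_refl] assms(5) by blast
  then show ?thesis
    using assms(2,5) by simp
qed

section \<open>Subspaces attached to a vector and an endomorphism without choice of basis\<close>

context graded_nilpotent
begin

interpretation lp: vector_space_pair scale scale
  by unfold_locales

definition graded_commutant :: "('v \<Rightarrow> 'v) set" where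
  "graded_commutant =
    {\<phi>. lin \<phi> \<and> (\<forall>w. \<phi> (x w) = x (\<phi> w)) \<and> (\<forall>c\<in>colors n. \<phi> ` V c \<subseteq> V c)}"

text \<open>The cyclic module generated by \<open>v\<close> over the algebra of graded endomorphisms
  commuting with \<open>x\<close>. No Jordan basis enters, which makes it an invariant of the
  pair.\<close>

definition orbit_space :: "'v \<Rightarrow> 'v set" where
  "orbit_space v = (\<lambda>\<phi>. \<phi> v) ` graded_commutant"

lemma graded_commutant_xk: "\<phi> \<in> graded_commutant \<Longrightarrow> \<phi> ((x ^^ k) w) = (x ^^ k) (\<phi> w)"
  by (induction k) (auto simp: graded_commutant_def)

lemma subspace_orbit_space: "subspace (orbit_space v)"
proof (rule subspaceI)
  have "(\<lambda>_. 0) \<in> graded_commutant"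
    using lp.linear_zero lin_0[OF lin_x] subspace_0[OF subspace_V]
    by (auto simp: graded_commutant_def)
  then show "0 \<in> orbit_space v"
    unfolding orbit_space_def by (rule rev_image_eqI) simp
next
  fix u w assume "u \<in> orbit_space v" "w \<in> orbit_space v"
  then obtain \<phi> \<psi> where *: "\<phi> \<in> graded_commutant" "u = \<phi> v" "\<psi> \<in> graded_commutant" "w = \<psi> v"
    unfolding orbit_space_def by auto
  then have "(\<lambda>z. \<phi> z + \<psi> z) \<in> graded_commutant"
    using lp.linear_compose_add lin_add[OF lin_x] subspace_add[OF subspace_V]
    by (auto simp: graded_commutant_def image_subset_iff)
  then show "u + w \<in> orbit_space v"
    unfolding orbit_space_def * by (rule rev_image_eqI) simp
next
  fix r u assume "u \<in> orbit_space v"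
  then obtain \<phi> where *: "\<phi> \<in> graded_commutant" "u = \<phi> v"
    unfolding orbit_space_def by auto
  then have "(\<lambda>z. scale r (\<phi> z)) \<in> graded_commutant"
    using lp.linear_compose_scale_right lin_scale[OF lin_x] subspace_scale[OF subspace_V]
    by (auto simp: graded_commutant_def image_subset_iff)
  then show "scale r u \<in> orbit_space v"
    unfolding orbit_space_def * by (rule rev_image_eqI) simp
qed

end

context graded_nilpotent
begin

text \<open>For marks \<open>a \<le> 0\<close> the vector \<open>v\<close> carries no information and only colors are counted.\<close>

definition mark_space :: "int \<Rightarrow> 'v \<Rightarrow> int \<Rightarrow> 'v set" where
  "mark_space m v a =
    (if 1 \<le> a then (x ^^ nat (a - 1)) ` orbit_space v else V (color_of n (m + (a - 1))))"

end

section \<open>Subspaces spanned by boxes of a fixed Jordan basis\<close>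

locale jordan = graded_nilpotent scale n V x
  for scale :: "'k::field \<Rightarrow> 'v::ab_group_add \<Rightarrow> 'v" and n :: nat and V :: "int \<Rightarrow> 'v set"
    and x :: "'v \<Rightarrow> 'v" +
  fixes lam :: "nat \<Rightarrow> nat" and eps :: "nat \<Rightarrow> int" and b :: "nat \<Rightarrow> int \<Rightarrow> 'v"
  assumes part: "is_partition lam" and Jordan: "colored_Jordan_basis x lam eps b"
begin

interpretation lp: vector_space_pair scale scale
  by unfold_locales

abbreviation f :: "nat \<times> int \<Rightarrow> 'v" where
  "f \<equiv> \<lambda>(i, j). b i j"

abbreviation col :: "nat \<times> int \<Rightarrow> int" where
  "col \<equiv> box_color n lam eps"

abbreviation sp :: "(nat \<times> int) set \<Rightarrow> 'v set" where
  "sp A \<equiv> span (f ` A)"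

lemmas basis = Jordan_basisD[OF Jordan part]

lemma less_length: "i < part_length lam \<longleftrightarrow> 0 < lam i"
  by (rule part_length_less_iff[OF part])

lemma col_diff: "int n dvd d \<Longrightarrow> col (i, j - d) = col (i, j)"
  by (simp add: box_color_def color_of_eq_iff)

lemma sp_Int: "A \<subseteq> boxes lam \<Longrightarrow> C \<subseteq> boxes lam \<Longrightarrow> sp A \<inter> sp C = sp (A \<inter> C)"
  using span_Int_independent[OF basis(2), of "f ` A" "f ` C"] inj_on_image_Int[OF basis(1), of A C]
  by (simp add: image_mono)

lemma dim_sp: "A \<subseteq> boxes lam \<Longrightarrow> dim (sp A) = card A"
  using dim_span_eq_card_independent[OF independent_mono[OF basis(2) image_mono]]
    card_image[OF inj_on_subset[OF basis(1)]] by simp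

lemma xk_b:
  assumes "0 < lam i" "j \<le> int (lam i)"
  shows "(x ^^ k) (b i j) = b i (j - int k)"
proof (induction k)
  case (Suc k)
  have "x (b i (j - int k)) = b i (j - int k - 1)"
  proof (cases "1 \<le> j - int k")
    case True
    then show ?thesis
      using assms basis(5)[of i "j - int k"] by simp
  next
    case False
    then show ?thesis
      using assms basis(6)[of i] lin_0[OF lin_x] by (simp add: less_length)
  qed
  then show ?case
    using Suc by (simp add: algebra_simps)
qed simp

lemma b_nonpos: "0 < lam i \<Longrightarrow> j \<le> 0 \<Longrightarrow> b i j = 0"
  using basis(6) by (simp add: less_length)

text \<open>Boxes move down by \<open>k\<close> and vanish below height 1, so spans of boxes are
  mapped to spans of boxes. Dimensions of all subspaces built this way are then box counts.\<close>

lemma xk_sp: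
  assumes "A \<subseteq> boxes lam"
  shows "(x ^^ k) ` sp A = sp {(i, j) \<in> boxes lam. (i, j + int k) \<in> A}"
proof -
  have "span ((x ^^ k) ` f ` A) = sp {(i, j) \<in> boxes lam. (i, j + int k) \<in> A}"
  proof (rule subset_antisym; rule span_minimal; (rule subspace_span)?)
    show "(x ^^ k) ` f ` A \<subseteq> sp {(i, j) \<in> boxes lam. (i, j + int k) \<in> A}"
    proof clarify
      fix i j assume ij: "(i, j) \<in> A"
      then have "(i, j) \<in> boxes lam"
        using assms by blast
      then have *: "0 < lam i" "j \<le> int (lam i)"
        by auto
      show "(x ^^ k) (b i j) \<in> sp {(i, j) \<in> boxes lam. (i, j + int k) \<in> A}"
      proof (cases "1 \<le> j - int k")
        case True
        then show ?thesis
          unfolding xk_b[OF *] using * ij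
          by (intro span_base image_eqI[of _ _ "(i, j - int k)"]) auto
      next
        case False
        then show ?thesis
          unfolding xk_b[OF *] using b_nonpos[OF *(1)] by (simp add: span_zero)
      qed
    qed
    show "f ` {(i, j) \<in> boxes lam. (i, j + int k) \<in> A} \<subseteq> span ((x ^^ k) ` f ` A)"
    proof clarify
      fix i j assume ij: "(i, j) \<in> boxes lam" "(i, j + int k) \<in> A"
      then have "(i, j + int k) \<in> boxes lam"
        using assms by blast
      then have "b i j = (x ^^ k) (f (i, j + int k))"
        using ij xk_b[of i "j + int k" k] by auto
      then show "b i j \<in> span ((x ^^ k) ` f ` A)"
        using ij(2) by (auto intro: span_base)
    qed
  qed
  then show ?thesis
    by (simp add: lin_span_image[OF lin_xk])
qed

text \<open>\<open>x ^^ k\<close> maps the boxes above height \<open>k\<close> injectively to basis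
  vectors and kills the others, so a kernel vector has zero coefficients at the former.\<close>

lemma kernel_xk:
  assumes "(x ^^ k) w = 0"
  shows "w \<in> sp {(i, j) \<in> boxes lam. j \<le> int k}"
proof -
  have "w \<in> sp (boxes lam)"
    by (simp add: basis(3))
  then obtain r where r: "w = (\<Sum>p\<in>boxes lam. scale (r p) (f p))"
    using family_sum_of_span[OF finite_boxes[OF part]] by blast
  let ?I = "{(i, j) \<in> boxes lam. int k < j}"
  let ?g = "\<lambda>(i, j). (i, j - int k)"
  have finI: "finite ?I"
    using finite_boxes[OF part] by (rule rev_finite_subset) auto
  have xf: "(x ^^ k) (f p) = f (?g p)" if "p \<in> boxes lam" for p
    using that xk_b by (cases p) auto
  have sub: "?g ` ?I \<subseteq> boxes lam"
    by auto
  have "inj_on ?g ?I"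
    by (auto simp: inj_on_def)
  then have inj: "inj_on (f \<circ> ?g) ?I"
    using inj_on_subset[OF basis(1) sub] by (rule comp_inj_on)
  have indep: "independent ((f \<circ> ?g) ` ?I)"
    unfolding image_comp[symmetric] using basis(2) image_mono[OF sub] by (rule independent_mono)
  have "0 = (\<Sum>p\<in>boxes lam. scale (r p) (f (?g p)))"
    using assms unfolding r lin_sum[OF lin_xk] lin_scale[OF lin_xk] by (simp add: xf cong: sum.cong)
  also have "\<dots> = (\<Sum>p\<in>?I. scale (r p) ((f \<circ> ?g) p))"
  proof (rule sum.mono_neutral_cong_right[OF finite_boxes[OF part]])
    show "\<forall>p\<in>boxes lam - ?I. scale (r p) (f (?g p)) = 0"
    proof
      fix p assume p: "p \<in> boxes lam - ?I"
      obtain i j where ij: "p = (i, j)"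
        by (cases p)
      then have "0 < lam i" "j - int k \<le> 0"
        using p by auto
      then show "scale (r p) (f (?g p)) = 0"
        by (simp add: b_nonpos ij)
    qed
  qed auto
  finally have "r p = 0" if "p \<in> ?I" for p
    using family_coeff_zero[OF finI inj indep _ that] by simp
  then have "scale (r p) (f p) \<in> sp {(i, j) \<in> boxes lam. j \<le> int k}" if "p \<in> boxes lam" for p
  proof (cases "p \<in> ?I")
    case False
    then have "p \<in> {(i, j) \<in> boxes lam. j \<le> int k}"
      using that by (cases p) auto
    then show ?thesis
      by (intro span_scale span_base imageI)
  qed (simp add: \<open>\<And>p. p \<in> ?I \<Longrightarrow> r p = 0\<close> span_zero)
  then show ?thesis
    unfolding r by (rule span_sum)
qed

lemma V_sp: "c \<in> colors n \<Longrightarrow> V c = sp {p \<in> boxes lam. col p = c}"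
  by (rule Jordan_V(1)[OF Jordan part])

text \<open>The projection to row \<open>i\<close> followed by a shift down by \<open>d\<close>.
  Rows are stable under \<open>x\<close>, so it commutes with \<open>x\<close>; it keeps colors
  because \<open>n\<close> divides \<open>d\<close>. Such maps isolate a single row of the marked
  vector.\<close>

lemma shift_in_commutant:
  assumes "0 \<le> d" "int n dvd d"
  shows "\<exists>\<phi>\<in>graded_commutant. \<forall>k j. 0 < lam k \<longrightarrow> j \<le> int (lam k) \<longrightarrow>
    \<phi> (b k j) = (if k = i then b k (j - d) else 0)"
proof -
  let ?t = "\<lambda>(k, j). if k = i then b k (j - d) else 0"
  obtain \<phi> where \<phi>: "lin \<phi>" "\<forall>p\<in>boxes lam. \<phi> (f p) = ?t p"
    using family_lin_extend[OF basis(1,2), of ?t] by blast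
  have \<phi>b: "\<phi> (b k j) = (if k = i then b k (j - d) else 0)" if "0 < lam k" "j \<le> int (lam k)" for k j
  proof (cases "1 \<le> j")
    case True
    then have "(k, j) \<in> boxes lam"
      using that by simp
    from bspec[OF \<phi>(2) this] show ?thesis
      by simp
  next
    case False
    then show ?thesis
      using that assms(1) b_nonpos[of k] lin_0[OF \<phi>(1)] by (cases "k = i") auto
  qed
  have "(\<phi> \<circ> x) w = (x \<circ> \<phi>) w" for w
  proof (rule lin_eq_on_span[OF lin_comp[OF \<phi>(1) lin_x] lin_comp[OF lin_x \<phi>(1)]])
    show "w \<in> sp (boxes lam)"
      by (simp add: basis(3))
    fix z assume "z \<in> f ` boxes lam"
    then obtain k j where kj: "z = b k j" "(k, j) \<in> boxes lam"
      by auto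
    then have *: "0 < lam k" "j \<le> int (lam k)" "j - 1 \<le> int (lam k)" "j - d \<le> int (lam k)"
      using assms(1) by auto
    show "(\<phi> \<circ> x) z = (x \<circ> \<phi>) z"
      using xk_b[OF *(1,2), of 1] xk_b[OF *(1,4), of 1] \<phi>b[OF *(1,2)] \<phi>b[OF *(1,3)] lin_0[OF lin_x]
      by (cases "k = i") (simp_all add: kj(1) algebra_simps)
  qed
  moreover have "\<phi> ` V c \<subseteq> V c" if c: "c \<in> colors n" for c
  proof -
    have "\<phi> ` f ` {p \<in> boxes lam. col p = c} \<subseteq> V c"
    proof clarify
      fix k j assume kj: "(k, j) \<in> boxes lam" "c = col (k, j)"
      have zero: "0 \<in> V (col (k, j))"
        by (intro subspace_0 subspace_V) simp
      have "b k (j - d) \<in> V (col (k, j))"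
      proof (cases "1 \<le> j - d")
        case True
        then show ?thesis
          using kj(1) assms(1) basis(4)[of k "j - d"] col_diff[OF assms(2), of k j] by simp
      next
        case False
        then show ?thesis
          using kj(1) b_nonpos[of k "j - d"] zero by auto
      qed
      moreover have "0 < lam k" "j \<le> int (lam k)"
        using kj(1) by auto
      ultimately show "\<phi> (b k j) \<in> V (col (k, j))"
        using \<phi>b zero by (cases "k = i") simp_all
    qed
    then have "span (\<phi> ` f ` {p \<in> boxes lam. col p = c}) \<subseteq> V c"
      by (intro span_minimal subspace_V c)
    then show ?thesis
      using V_sp[OF c] by (simp add: lin_span_image[OF \<phi>(1)])
  qed
  ultimately have "\<phi> \<in> graded_commutant"
    using \<phi>(1) by (auto simp: graded_commutant_def fun_eq_iff)
  then show ?thesis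
    using \<phi>b by blast
qed

context
  fixes mu :: "nat \<Rightarrow> int" and m :: int
  assumes striped: "(lam, eps, mu) \<in> striped_bipartitions_over m"
begin

lemmas str = striped_overD[OF striped]

lemma m_color: "m \<in> colors n"
  using str(7)[of 0] by auto

definition marked_boxes :: "(nat \<times> int) set" where
  "marked_boxes = {(i, j) \<in> boxes lam. j \<le> mu i \<and> col (i, j) = m}"

abbreviation marked_vector :: 'v where
  "marked_vector \<equiv> (\<Sum>i<part_length lam. b i (mu i))"

lemma col_eq_m_iff: "col (i, j) = m \<longleftrightarrow> int n dvd j - mu i"
proof -
  have "col (i, j) = m \<longleftrightarrow> col (i, j) = color_of n (eps i + (int (lam i) - mu i))"
    by (simp only: str(7))
  also have "\<dots> \<longleftrightarrow> int n dvd mu i - j"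
    by (simp add: box_color_def color_of_eq_iff)
  finally show ?thesis
    by (simp add: dvd_diff_commute)
qed

lemma mu_le: "mu i \<le> int (lam i)"
  using str(2) by (simp add: is_marking_def)

text \<open>
  An element of the commutant can move the mark of row \<open>k\<close> in row \<open>i\<close> at most up to
  \<open>min (mu k) (lam i - nu k)\<close>, which is less than \<open>mu i + n\<close> by the striped condition.
\<close>

lemma commutant_mark:
  assumes \<phi>: "\<phi> \<in> graded_commutant" and k: "0 < lam k"
  shows "\<phi> (b k (mu k)) \<in> sp marked_boxes"
proof (cases "0 < mu k")
  case False
  have "lin \<phi>"
    using \<phi> by (simp add: graded_commutant_def)
  then show ?thesis
    using b_nonpos[OF k, of "mu k"] False lin_0[of \<phi>] by (simp add: span_zero)
next
  case True
  \<comment> \<open>The marked vector of row \<open>k\<close> is \<open>x ^^ nu\<close> applied to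
    the top of the row. The top is killed by \<open>x ^^ lam k\<close>, so its image has height at
    most \<open>lam k\<close>; \<open>?B\<close> is what remains after lowering by
    \<open>nu\<close>.\<close>
  define nu where "nu = nat (int (lam k) - mu k)"
  have nu: "int nu = int (lam k) - mu k"
    using mu_le by (simp add: nu_def)
  let ?A = "{(i, j) \<in> boxes lam. j \<le> int (lam k)}"
  let ?B = "{(i, j) \<in> boxes lam. (i, j + int nu) \<in> ?A}"
  have "(x ^^ lam k) (\<phi> (b k (int (lam k)))) = 0"
    using graded_commutant_xk[OF \<phi>, of "lam k" "b k (int (lam k))"] xk_b[OF k, of "int (lam k)" "lam k"]
      b_nonpos[OF k, of 0] lin_0[of \<phi>] \<phi> by (simp add: graded_commutant_def)
  then have "\<phi> (b k (int (lam k))) \<in> sp ?A"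
    by (rule kernel_xk)
  moreover have "\<phi> (b k (mu k)) = (x ^^ nu) (\<phi> (b k (int (lam k))))"
    using graded_commutant_xk[OF \<phi>, of nu "b k (int (lam k))"] xk_b[OF k, of "int (lam k)" nu]
    by (simp add: nu)
  moreover have "(x ^^ nu) ` sp ?A = sp ?B"
    by (rule xk_sp) auto
  ultimately have 1: "\<phi> (b k (mu k)) \<in> sp ?B"
    by (metis (no_types, lifting) imageI)
  have "col (k, mu k) = m"
    by (simp add: col_eq_m_iff)
  then have "b k (mu k) \<in> V m"
    using basis(4)[of k "mu k"] True mu_le by simp
  then have "\<phi> (b k (mu k)) \<in> V m"
    using \<phi> m_color by (auto simp: graded_commutant_def)
  then have 2: "\<phi> (b k (mu k)) \<in> sp {p \<in> boxes lam. col p = m}"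
    using V_sp[OF m_color] by simp
  have "sp ?B \<inter> sp {p \<in> boxes lam. col p = m} = sp (?B \<inter> {p \<in> boxes lam. col p = m})"
    by (rule sp_Int) auto
  also have "?B \<inter> {p \<in> boxes lam. col p = m} \<subseteq> marked_boxes"
  proof
    fix p assume p: "p \<in> ?B \<inter> {p \<in> boxes lam. col p = m}"
    obtain i j where "p = (i, j)"
      by (cases p)
    with p have ij: "(i, j) \<in> boxes lam" "(i, j + int nu) \<in> boxes lam"
      "j + int nu \<le> int (lam k)" "col (i, j) = m" and p_eq: "p = (i, j)"
      by auto
    \<comment> \<open>The boxes of \<open>?B\<close> satisfy \<open>j \<le> mu k\<close> and
      \<open>j \<le> lam i - nu\<close>. The first bound suffices for \<open>i < k\<close> by the
      inequality of marks, the second for \<open>k < i\<close> by that of comarks.\<close>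
    have "j < mu i + int n"
    proof (cases k i rule: linorder_cases)
      case less
      then show ?thesis
        using str(6)[OF less] ij nu by auto
    next
      case equal
      then show ?thesis
        using ij nu n_pos by auto
    next
      case greater
      then show ?thesis
        using str(5)[OF greater] ij nu by auto
    qed
    moreover have "j mod int n = mu i mod int n"
      using ij(4) col_eq_m_iff[of i j] by (simp add: mod_eq_dvd_iff)
    ultimately have "j \<le> mu i"
      using cong_lower_bound by blast
    then show "p \<in> marked_boxes"
      using ij by (simp add: marked_boxes_def p_eq)
  qed
  then have "sp (?B \<inter> {p \<in> boxes lam. col p = m}) \<subseteq> sp marked_boxes"
    by (intro span_mono image_mono)
  finally show ?thesis
    using 1 2 by blast
qed

text \<open>The upper bound adds up \<open>commutant_mark\<close> over the rows. For the lower
  bound, a marked box of row \<open>i\<close> lies below the mark by a multiple of \<open>n\<close>;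
  the corresponding shift of row \<open>i\<close> annihilates all other summands and hits exactly
  this box.\<close>

lemma orbit_space_sp: "orbit_space marked_vector = sp marked_boxes"
proof
  show "orbit_space marked_vector \<subseteq> sp marked_boxes"
  proof (unfold orbit_space_def, rule image_subsetI)
    fix \<phi> assume \<phi>: "\<phi> \<in> graded_commutant"
    then have "lin \<phi>"
      by (simp add: graded_commutant_def)
    then show "\<phi> marked_vector \<in> sp marked_boxes"
      using commutant_mark[OF \<phi>] by (simp only: lin_sum) (auto simp: less_length intro: span_sum)
  qed
  have "f ` marked_boxes \<subseteq> orbit_space marked_vector"
  proof clarify
    fix i j assume ij: "(i, j) \<in> marked_boxes"
    then have *: "1 \<le> j" "j \<le> mu i" "int n dvd mu i - j" "0 < lam i"
      using col_eq_m_iff[of i j] by (auto simp: marked_boxes_def dvd_diff_commute)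
    then obtain \<phi> where \<phi>: "\<phi> \<in> graded_commutant" "\<And>k j'. 0 < lam k \<Longrightarrow> j' \<le> int (lam k) \<Longrightarrow>
        \<phi> (b k j') = (if k = i then b k (j' - (mu i - j)) else 0)"
      using shift_in_commutant[of "mu i - j" i] by auto
    have "\<phi> marked_vector = (\<Sum>k<part_length lam. \<phi> (b k (mu k)))"
      using \<phi>(1) by (intro lin_sum) (simp add: graded_commutant_def)
    also have "\<dots> = (\<Sum>k<part_length lam. if k = i then b i j else 0)"
      using \<phi>(2) mu_le by (intro sum.cong) (auto simp: less_length)
    also have "\<dots> = b i j"
      using *(4) by (simp add: less_length)
    finally have "\<phi> marked_vector = b i j" .
    then show "b i j \<in> orbit_space marked_vector"
      unfolding orbit_space_def by (rule image_eqI[OF sym \<phi>(1)])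
  qed
  then show "sp marked_boxes \<subseteq> orbit_space marked_vector"
    by (intro span_minimal subspace_orbit_space)
qed

text \<open>Only bottom boxes matter later. For \<open>a \<ge> 1\<close>, the shift by
  \<open>a - 1\<close> takes height \<open>a\<close> to the bottom. For \<open>a \<le> 0\<close>,
  the bottom of row \<open>i\<close> has color \<open>m + mu i - 1\<close>, so the color tests the
  congruence, and \<open>a \<le> mu i\<close> then follows from \<open>mu i > -n\<close>.\<close>

lemma mark_space_sp:
  assumes "- int n < a"
  shows "\<exists>A\<subseteq>boxes lam. mark_space m marked_vector a = sp A \<and>
    (\<forall>i. (i, 1) \<in> A \<longleftrightarrow> 0 < lam i \<and> a \<le> mu i \<and> mu i mod int n = a mod int n)"
proof (cases "1 \<le> a")
  case True
  let ?A = "{(i, j) \<in> boxes lam. (i, j + int (nat (a - 1))) \<in> marked_boxes}"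
  have sub: "marked_boxes \<subseteq> boxes lam"
    by (auto simp: marked_boxes_def)
  have "mark_space m marked_vector a = sp ?A"
    unfolding mark_space_def orbit_space_sp by (simp only: True if_True xk_sp[OF sub])
  moreover have "(i, 1) \<in> ?A \<longleftrightarrow> 0 < lam i \<and> a \<le> mu i \<and> mu i mod int n = a mod int n" for i
    using True mu_le[of i] col_eq_m_iff[of i a]
    by (auto simp: marked_boxes_def mod_eq_dvd_iff dvd_diff_commute)
  ultimately show ?thesis
    by (intro exI[of _ ?A]) auto
next
  case False
  let ?A = "{p \<in> boxes lam. col p = color_of n (m + (a - 1))}"
  have "mark_space m marked_vector a = sp ?A"
    using False V_sp[of "color_of n (m + (a - 1))"] by (simp add: mark_space_def)
  moreover have "(i, 1) \<in> ?A \<longleftrightarrow> 0 < lam i \<and> a \<le> mu i \<and> mu i mod int n = a mod int n" for i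
  proof -
    have "color_of n (m + (a - 1)) = color_of n (eps i + (int (lam i) - mu i) + (a - 1))"
      using str(7)[of i] color_of_add_left by metis
    then have "col (i, 1) = color_of n (m + (a - 1)) \<longleftrightarrow>
        col (i, 1) = color_of n (eps i + (int (lam i) - mu i) + (a - 1))"
      by (simp only:)
    also have "\<dots> \<longleftrightarrow> mu i mod int n = a mod int n"
      by (simp add: box_color_def color_of_eq_iff mod_eq_dvd_iff)
    finally have "col (i, 1) = color_of n (m + (a - 1)) \<longleftrightarrow> mu i mod int n = a mod int n" .
    moreover have "a \<le> mu i" if "mu i mod int n = a mod int n"
      using that False str(4)[of i] cong_lower_bound[of a "int n" "mu i"] by simp
    ultimately show ?thesis
      by auto
  qed
  ultimately show ?thesis
    by (intro exI[of _ ?A]) auto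
qed

end

text \<open>The intersection on the left is spanned by the boxes of \<open>A\<close> with at least
  \<open>p\<close> boxes above them. Those of height 2 or more correspond, one step down, to the
  boxes of the intersection on the right; the others are bottoms of rows longer than
  \<open>p\<close>.\<close>

lemma dim_bottoms:
  assumes A: "A \<subseteq> boxes lam"
  shows "dim (range (x ^^ p) \<inter> sp A) =
    dim (range (x ^^ Suc p) \<inter> x ` sp A) + card {i. (i, 1) \<in> A \<and> p < lam i}"
proof -
  define B where "B q = {(i, j) \<in> boxes lam. (i, j + int q) \<in> boxes lam}" for q
  define A' where "A' = {(i, j) \<in> boxes lam. (i, j + 1) \<in> A}"
  have B: "range (x ^^ q) = sp (B q)" "B q \<subseteq> boxes lam" for q
    using xk_sp[OF subset_refl, of q] by (auto simp: basis(3) B_def)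
  have A': "x ` sp A = sp A'" "A' \<subseteq> boxes lam"
    using xk_sp[OF A, of 1] by (auto simp: A'_def)
  have fin: "finite C" if "C \<subseteq> boxes lam" for C
    using finite_boxes[OF part] that by (rule rev_finite_subset)
  let ?D = "{(i, j) \<in> B p \<inter> A. j = 1}" and ?E = "{(i, j) \<in> B p \<inter> A. 2 \<le> j}"
  have "bij_betw (\<lambda>i. (i, 1 :: int)) {i. (i, 1) \<in> A \<and> p < lam i} ?D"
    using A by (intro bij_betw_byWitness[where f' = fst]) (auto simp: B_def)
  then have D: "card {i. (i, 1) \<in> A \<and> p < lam i} = card ?D"
    by (rule bij_betw_same_card)
  have "bij_betw (\<lambda>(i, j). (i, j + 1)) (B (Suc p) \<inter> A') ?E"
    using A by (intro bij_betw_byWitness[where f' = "\<lambda>(i, j). (i, j - 1)"])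
      (auto simp: B_def A'_def algebra_simps)
  then have E: "card (B (Suc p) \<inter> A') = card ?E"
    by (rule bij_betw_same_card)
  have "card (B p \<inter> A) = card (?E \<union> ?D)"
    by (rule arg_cong[of _ _ card]) (auto simp: B_def)
  also have "\<dots> = card ?E + card ?D"
    using A by (intro card_Un_disjoint fin) auto
  also have "\<dots> = card (B (Suc p) \<inter> A') + card {i. (i, 1) \<in> A \<and> p < lam i}"
    by (simp only: D E)
  finally have "card (B p \<inter> A) = card (B (Suc p) \<inter> A') + card {i. (i, 1) \<in> A \<and> p < lam i}" .
  moreover have "dim (sp (B p) \<inter> sp A) = card (B p \<inter> A)"
    using sp_Int[OF B(2) A] dim_sp[of "B p \<inter> A"] A by auto
  moreover have "dim (sp (B (Suc p)) \<inter> sp A') = card (B (Suc p) \<inter> A')"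
    using sp_Int[OF B(2) A'(2)] dim_sp[of "B (Suc p) \<inter> A'"] A'(2) by auto
  ultimately show ?thesis
    unfolding B(1) A'(1) by simp
qed

text \<open>The right-hand side involves \<open>v\<close>, \<open>x\<close> and the grading but no
  basis, so it takes the same value for any two striped types realized by the same pair.\<close>

lemma card_marks:
  assumes "(lam, eps, mu) \<in> striped_bipartitions_over m" "- int n < a"
    and v: "v = (\<Sum>i<part_length lam. b i (mu i))"
  shows "card {i. p < lam i \<and> a \<le> mu i \<and> mu i mod int n = a mod int n} =
    dim (range (x ^^ p) \<inter> mark_space m v a) - dim (range (x ^^ Suc p) \<inter> x ` mark_space m v a)"
proof -
  obtain A where A: "A \<subseteq> boxes lam" "mark_space m v a = sp A"
    "\<And>i. (i, 1) \<in> A \<longleftrightarrow> 0 < lam i \<and> a \<le> mu i \<and> mu i mod int n = a mod int n"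
    using mark_space_sp[OF assms(1,2)] unfolding v by blast
  have "{i. p < lam i \<and> a \<le> mu i \<and> mu i mod int n = a mod int n} = {i. (i, 1) \<in> A \<and> p < lam i}"
    unfolding A(3) by (rule Collect_cong) auto
  then show ?thesis
    unfolding A(2) dim_bottoms[OF A(1), of p] by simp
qed

end

section \<open>Multiplicities of rows and the resulting permutation\<close>

text \<open>Cumulative in length and mark, as the dimensions provide it. Exact multiplicities are
  differences, taken in steps of \<open>n\<close> for the mark and of 1 for the length.\<close>

definition num_marks :: "nat \<Rightarrow> (nat \<Rightarrow> nat) \<Rightarrow> (nat \<Rightarrow> int) \<Rightarrow> nat \<Rightarrow> int \<Rightarrow> nat" where
  "num_marks n lam mu p a = card {i. p < lam i \<and> a \<le> mu i \<and> mu i mod int n = a mod int n}"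

lemma finite_rows: "is_partition lam \<Longrightarrow> finite {i. p < lam i}"
  by (rule finite_subset[of _ "{..<part_length lam}"]) (auto simp: part_length_less_iff)

lemma num_marks_rec:
  assumes "is_partition lam" "n \<ge> 1"
  shows "num_marks n lam mu p a =
    card {i. p < lam i \<and> mu i = a} + num_marks n lam mu p (a + int n)"
proof -
  have le: "a + int n \<le> k" if "a \<le> k" "k mod int n = a mod int n" "k \<noteq> a" for k
    using cong_lower_bound[of "a + int n" "int n" k] that by (simp add: not_less)
  have "{i. p < lam i \<and> a \<le> mu i \<and> mu i mod int n = a mod int n} =
    {i. p < lam i \<and> mu i = a} \<union>
    {i. p < lam i \<and> a + int n \<le> mu i \<and> mu i mod int n = (a + int n) mod int n}"
    using assms(2) le by auto
  moreover have "card \<dots> = card {i. p < lam i \<and> mu i = a} +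
    card {i. p < lam i \<and> a + int n \<le> mu i \<and> mu i mod int n = (a + int n) mod int n}"
    using assms(2) by (intro card_Un_disjoint finite_subset[OF _ finite_rows[OF assms(1), of p]]) auto
  ultimately show ?thesis
    by (simp add: num_marks_def)
qed

lemma card_rows_rec:
  assumes "is_partition lam"
  shows "card {i. p < lam i \<and> mu i = a} =
    card {i. lam i = Suc p \<and> mu i = a} + card {i. Suc p < lam i \<and> mu i = a}"
proof -
  have "{i. p < lam i \<and> mu i = a} =
    {i. lam i = Suc p \<and> mu i = a} \<union> {i. Suc p < lam i \<and> mu i = a}"
    by auto
  moreover have "card \<dots> = card {i. lam i = Suc p \<and> mu i = a} + card {i. Suc p < lam i \<and> mu i = a}"
    by (intro card_Un_disjoint finite_subset[OF _ finite_rows[OF assms, of p]]) auto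
  ultimately show ?thesis
    by simp
qed

lemma card_rows_eq:
  assumes part: "is_partition lam" "is_partition lam'" and n: "n \<ge> 1"
    and eq: "\<And>p a. - int n < a \<Longrightarrow> num_marks n lam mu p a = num_marks n lam' mu' p a"
    and a: "- int n < a"
  shows "card {i. lam i = Suc p \<and> mu i = a} = card {i. lam' i = Suc p \<and> mu' i = a}"
proof -
  have "card {i. p < lam i \<and> mu i = a} = card {i. p < lam' i \<and> mu' i = a}" for p
    using num_marks_rec[OF part(1) n, of mu p a] num_marks_rec[OF part(2) n, of mu' p a]
      eq[of a p] eq[of "a + int n" p] a by simp
  then show ?thesis
    using card_rows_rec[OF part(1), of p mu a] card_rows_rec[OF part(2), of p mu' a] by simp
qed

context colored_vector_space
begin

text \<open>The mark of an empty row lies among \<open>n\<close> consecutive values, so its color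
  fixes it; and all but finitely many of the infinitely many rows of color \<open>e\<close> are
  empty.\<close>

lemma empty_row_fibre:
  assumes P: "(lam, eps, mu) \<in> striped_bipartitions_over m" and e: "e \<in> colors n"
    and a: "color_of n (e - a) = m" "- int n < a" "a \<le> 0"
  shows "infinite {i. (lam i, eps i, mu i) = (0, e, a)}"
proof -
  note D = striped_overD[OF P]
  have "mu i = a" if "lam i = 0" "eps i = e" for i
  proof -
    have "color_of n (e - mu i) = color_of n (e - a)"
      using D(7)[of i] that a(1) by simp
    then have cong: "mu i mod int n = a mod int n"
      by (simp add: color_of_eq_iff mod_eq_dvd_iff dvd_diff_commute)
    have "mu i \<le> 0"
      using D(2) that by (auto simp: is_marking_def dest: spec[of _ i])
    then show ?thesis
      using cong_lower_bound[OF cong] cong_lower_bound[OF cong[symmetric]] D(4)[of i] a by simp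
  qed
  then have "{i. eps i = e} - {i. 0 < lam i} \<subseteq> {i. (lam i, eps i, mu i) = (0, e, a)}"
    by auto
  moreover have "infinite ({i. eps i = e} - {i. 0 < lam i})"
    using D(9)[OF e] finite_rows[OF D(1), of 0] by (simp add: Diff_infinite_finite)
  ultimately show ?thesis
    using infinite_super by blast
qed

lemma empty_row:
  assumes "(lam, eps, mu) \<in> striped_bipartitions_over m" "lam i = 0"
  shows "eps i \<in> colors n" "color_of n (eps i - mu i) = m" "- int n < mu i" "mu i \<le> 0"
  using striped_overD(4,7,8)[OF assms(1), of i] striped_overD(2)[OF assms(1)] assms(2)
  by (auto simp: is_marking_def dest: spec[of _ i])

text \<open>Over a triple of length 0 the two fibres are both infinite or both empty. Over positive
  length they are finite: either the triple violates the color condition and both are empty, or they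
  are cut out by length and mark alone and counted by \<open>card_rows_eq\<close>.\<close>

lemma striped_fibres:
  assumes P: "(lam, eps, mu) \<in> striped_bipartitions_over m"
    and Q: "(lam', eps', mu') \<in> striped_bipartitions_over m"
    and eq: "\<And>p a. - int n < a \<Longrightarrow> num_marks n lam mu p a = num_marks n lam' mu' p a"
  shows "\<exists>h. bij_betw h {i. (lam' i, eps' i, mu' i) = t} {i. (lam i, eps i, mu i) = t}"
proof -
  note D = striped_overD[OF P] and D' = striped_overD[OF Q]
  obtain l e a where t: "t = (l, e, a)"
    by (cases t)
  show ?thesis
  proof (cases l)
    case 0
    show ?thesis
    proof (cases "e \<in> colors n \<and> color_of n (e - a) = m \<and> - int n < a \<and> a \<le> 0")
      case True
      then show ?thesis
        unfolding t 0 using empty_row_fibre[OF P, of e a] empty_row_fibre[OF Q, of e a]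
        by (intro ex_bij_betw_nat_sets) auto
    next
      case False
      have "{i. (lam i, eps i, mu i) = t} = {}"
        using False empty_row[OF P] unfolding t 0 by auto
      moreover have "{i. (lam' i, eps' i, mu' i) = t} = {}"
        using False empty_row[OF Q] unfolding t 0 by auto
      ultimately show ?thesis
        by auto
    qed
  next
    case (Suc p)
    have fibre: "{i. (lam i, eps i, mu i) = t} =
        (if e = color_of n (m - (int l - a)) \<and> - int n < a then {i. lam i = Suc p \<and> mu i = a} else {})"
      if "(lam, eps, mu) \<in> striped_bipartitions_over m" for lam eps mu
    proof -
      have "eps i = color_of n (m - (int (lam i) - mu i))" for i
        using striped_overD(7)[OF that, of i, symmetric] striped_overD(8)[OF that, of i] by simp
      then show ?thesis
        using striped_overD(4)[OF that] by (auto simp: t Suc)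
    qed
    show ?thesis
      unfolding fibre[OF P] fibre[OF Q]
    proof (cases "e = color_of n (m - (int l - a)) \<and> - int n < a")
      case True
      then have "card {i. lam i = Suc p \<and> mu i = a} = card {i. lam' i = Suc p \<and> mu' i = a}"
        using card_rows_eq[OF D(1) D'(1) n_pos eq] by blast
      moreover have "finite {i. lam i = Suc p \<and> mu i = a}" "finite {i. lam' i = Suc p \<and> mu' i = a}"
        using finite_rows[OF D(1), of p] finite_rows[OF D'(1), of p] by (auto elim: rev_finite_subset)
      ultimately show "\<exists>h. bij_betw h
          (if e = color_of n (m - (int l - a)) \<and> - int n < a then {i. lam' i = Suc p \<and> mu' i = a} else {})
          (if e = color_of n (m - (int l - a)) \<and> - int n < a then {i. lam i = Suc p \<and> mu i = a} else {})"
        using True by (simp add: finite_same_card_bij)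
    qed auto
  qed
qed

lemma row_equivI_num_marks:
  assumes P: "(lam, eps, mu) \<in> striped_bipartitions_over m"
    and Q: "(lam', eps', mu') \<in> striped_bipartitions_over m"
    and eq: "\<And>p a. - int n < a \<Longrightarrow> num_marks n lam mu p a = num_marks n lam' mu' p a"
  shows "((lam, eps, mu), (lam', eps', mu')) \<in> row_equiv"
proof -
  obtain p where p: "bij p" and "(\<lambda>i. (lam' i, eps' i, mu' i)) = (\<lambda>i. (lam i, eps i, mu i)) \<circ> p"
    using ex_bij_comp_eq[OF striped_fibres[OF P Q eq]] by blast
  then have row: "lam' i = lam (p i)" "eps' i = eps (p i)" "mu' i = mu (p i)" for i
    by (simp_all add: fun_eq_iff)
  \<comment> \<open>Row-equivalence demands equality of the length functions. Both are decreasing,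
    hence determined by the numbers of rows longer than \<open>q\<close>, and \<open>p\<close>
    identifies these rows.\<close>
  have "lam' i = lam i" for i
  proof -
    have "bij_betw p {k. q < lam' k} {k. q < lam k}" for q
    proof (rule bij_betw_imageI)
      show "inj_on p {k. q < lam' k}"
        using bij_is_inj[OF p] by (rule inj_on_subset) simp
      have "{k. q < lam' k} = p -` {k. q < lam k}"
        by (auto simp: row)
      then show "p ` {k. q < lam' k} = {k. q < lam k}"
        using surj_image_vimage_eq[OF bij_is_surj[OF p]] by metis
    qed
    then have "q < lam' i \<longleftrightarrow> q < lam i" for q
      using less_partition_iff[OF striped_overD(1)[OF P], of q i]
        less_partition_iff[OF striped_overD(1)[OF Q], of q i] bij_betw_same_card by metis
    then show ?thesis
      by (metis linorder_neqE_nat less_irrefl)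
  qed
  then show ?thesis
    unfolding row_equiv_def using p row by (auto intro!: exI[of _ p])
qed

lemma Psi_inj:
  assumes P: "P \<in> striped_bipartitions_over m" and Q: "Q \<in> striped_bipartitions_over m"
    and eq: "Psi P = Psi Q"
  shows "(P, Q) \<in> row_equiv"
proof -
  obtain lam eps mu lam' eps' mu' where PQ: "P = (lam, eps, mu)" "Q = (lam', eps', mu')"
    by (cases P, cases Q)
  note D = striped_overD[OF P[unfolded PQ]] and D' = striped_overD[OF Q[unfolded PQ]]
  obtain x b where x: "x \<in> nilcone" and jb: "colored_Jordan_basis x lam eps b"
    using ex_Jordan_basis[OF D(1,3)] by blast
  obtain y c where y: "y \<in> nilcone" and jc: "colored_Jordan_basis y lam' eps' c"
    using ex_Jordan_basis[OF D'(1,3)] by blast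
  let ?v = "\<Sum>i<part_length lam. b i (mu i)" and ?w = "\<Sum>i<part_length lam'. c i (mu' i)"
  have "(?w, y) \<in> K_orbit (?v, x)"
    using eq K_orbit_self Psi_eq[OF x jb D(1,2)] Psi_eq[OF y jc D'(1,2)] by (simp add: PQ)
  then obtain k where k: "k \<in> K" and w: "?w = k ?v" and y_eq: "y = k \<circ> x \<circ> inv k"
    unfolding K_orbit_def by (auto simp: act_def)
  \<comment> \<open>The first basis is transported by \<open>k\<close>, so that both types describe
    the same endomorphism \<open>y\<close> and the same vector \<open>?w\<close>.\<close>
  interpret graded_nilpotent scale n V y
    using y by unfold_locales
  interpret J: jordan scale n V y lam eps "\<lambda>i j. k (b i j)"
    using Jordan_basis_transport[OF k jb D(1)] D(1) by unfold_locales (simp_all add: y_eq)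
  interpret J': jordan scale n V y lam' eps' c
    using jc D'(1) by unfold_locales
  have w': "?w = (\<Sum>i<part_length lam. k (b i (mu i)))"
    unfolding w by (rule lin_sum[OF K_lin[OF k]])
  have "num_marks n lam mu p a = num_marks n lam' mu' p a" if "- int n < a" for p a
    unfolding num_marks_def
    using J.card_marks[OF P[unfolded PQ] that w'] J'.card_marks[OF Q[unfolded PQ] that refl] by simp
  then show ?thesis
    unfolding PQ by (rule row_equivI_num_marks[OF P[unfolded PQ] Q[unfolded PQ]])
qed

lemma Psi_in_orbits:
  assumes P: "P \<in> striped_bipartitions_over m" and m: "m \<in> colors n"
  shows "Psi P \<in> K_orbit ` (V m \<times> nilcone)"
proof -
  obtain lam eps mu where P_eq: "P = (lam, eps, mu)"
    by (cases P)
  note D = striped_overD[OF P[unfolded P_eq]]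
  obtain x b where x: "x \<in> nilcone" and jb: "colored_Jordan_basis x lam eps b"
    using ex_Jordan_basis[OF D(1,3)] by blast
  note J = Jordan_basisD[OF jb D(1)]
  have "b i (mu i) \<in> V m" if "i < part_length lam" for i
  proof (cases "mu i \<le> 0")
    case True
    then show ?thesis
      using J(6)[OF that] subspace_0[OF subspace_V[OF m]] by simp
  next
    case False
    then have "(i, mu i) \<in> boxes lam"
      using D(2) by (simp add: is_marking_def)
    from J(4)[OF this] show ?thesis
      using D(7)[of i] by (simp add: box_color_def)
  qed
  then have "(\<Sum>i<part_length lam. b i (mu i)) \<in> V m"
    by (intro subspace_sum subspace_V m) auto
  then show ?thesis
    using Psi_eq[OF x jb D(1,2)] x by (auto simp: P_eq)
qed

lemma orbit_in_Psi:
  assumes "v \<in> V m" "x \<in> nilcone" "m \<in> colors n"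
  shows "\<exists>P\<in>striped_bipartitions_over m. Psi P = K_orbit (v, x)"
proof -
  interpret graded_nilpotent scale n V x
    using assms(2) by unfold_locales
  obtain lam eps mu b where *: "(lam, eps, mu) \<in> striped_bipartitions_over m"
    "colored_Jordan_basis x lam eps b" "v = (\<Sum>i<part_length lam. b i (mu i))"
    using ex_striped_Jordan_basis[OF assms(1,3)] by blast
  then show ?thesis
    using Psi_eq[OF assms(2) *(2) striped_overD(1,2)[OF *(1)]] by auto
qed

end

theorem corollary4p13:
  fixes scale :: "'k::field \<Rightarrow> 'v::ab_group_add \<Rightarrow> 'v"
    and n :: nat and V :: "int \<Rightarrow> 'v set" and m :: int
  assumes "colored_vector_space scale n V"
    and "m \<in> colors n"
  shows "\<exists>F.
    (\<forall>P \<in> colored_vector_space.striped_bipartitions_over scale n V m.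
        F (row_equiv `` {P}) = colored_vector_space.Psi scale n V P) \<and>
    bij_betw F
      (colored_vector_space.striped_bipartitions_over scale n V m // row_equiv)
      (colored_vector_space.K_orbit scale n V `
         (V m \<times> colored_vector_space.nilcone scale n V))"
proof -
  interpret colored_vector_space scale n V
    by (fact assms(1))
  let ?S = "striped_bipartitions_over m"
  \<comment> \<open>Classes are formed among all marked triples, so the representative chosen is
    only known to be row-equivalent to a striped one; \<open>Psi_row_equiv\<close> is stated to
    cover this.\<close>
  define F where "F C = Psi (SOME Q. Q \<in> C)" for C
  have F: "F (row_equiv `` {P}) = Psi P" if "P \<in> ?S" for P
  proof -
    have "P \<in> row_equiv `` {P}"
      using equiv_class_self[OF equiv_row_equiv] by simp
    then have "(SOME Q. Q \<in> row_equiv `` {P}) \<in> row_equiv `` {P}"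
      by (rule someI)
    then show ?thesis
      unfolding F_def using Psi_row_equiv[OF that] by blast
  qed
  have "bij_betw F (?S // row_equiv) (K_orbit ` (V m \<times> nilcone))"
  proof (rule bij_betw_imageI)
    show "inj_on F (?S // row_equiv)"
    proof (rule inj_onI)
      fix C D assume CD: "C \<in> ?S // row_equiv" "D \<in> ?S // row_equiv" "F C = F D"
      then obtain P Q where PQ: "P \<in> ?S" "C = row_equiv `` {P}" "Q \<in> ?S" "D = row_equiv `` {Q}"
        by (auto elim!: quotientE)
      then have "(P, Q) \<in> row_equiv"
        using CD(3) F Psi_inj by simp
      then show "C = D"
        unfolding PQ by (rule equiv_class_eq[OF equiv_row_equiv])
    qed
    show "F ` (?S // row_equiv) = K_orbit ` (V m \<times> nilcone)"
    proof (intro equalityI subsetI)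
      fix Orb assume "Orb \<in> F ` (?S // row_equiv)"
      then obtain P where "P \<in> ?S" "Orb = F (row_equiv `` {P})"
        by (auto elim!: quotientE)
      then show "Orb \<in> K_orbit ` (V m \<times> nilcone)"
        using F Psi_in_orbits assms(2) by simp
    next
      fix Orb assume "Orb \<in> K_orbit ` (V m \<times> nilcone)"
      then obtain P where "P \<in> ?S" "Orb = Psi P"
        using orbit_in_Psi[OF _ _ assms(2)] by fastforce
      then show "Orb \<in> F ` (?S // row_equiv)"
        using F quotientI[of P ?S row_equiv] by (metis imageI)
    qed
  qed
  then show ?thesis
    using F by blast
qed

end
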